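(* Let $(X,D)$ be a metric space with base point $x_0$, $L=\mathrm{Lip}_0(X,D)$, and $P\subset L$ a cone. (i) If $(X,D)$ satisfies property $\mathbf{(S)}$ with respect to $P$, then $(\mathcal{F}(X,D),\|\cdot|_{\mathcal{F}_P})$ and $(\mathcal{F}_a(X,D_P),\|\cdot|_{\mathcal{F}_a})$ are identical. (ii) If $(X,D)$ satisfies property $\mathbf{(S^* )}$ (respectively $\mathbf{(S_0^* )}$) with respect to $P$, then $\mathcal{F}_a(X,D_P)$ endowed with the symmetrized norm $\|Q|_{\mathcal{F}_a}+\|{-Q}|_{\mathcal{F}_a}$ (respectively $\max\{\|Q|_{\mathcal{F}_a},\|{-Q}|_{\mathcal{F}_a}\}$) is isometrically isomorphic to $(\mathcal{F}(X,D),\|\cdot\|_{\mathcal{F}})$.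
   Context: Cones in a real vector space are convex cones. $\mathrm{Lip}_0(X,D)$ is the Banach space of real Lipschitz functions on $(X,D)$ vanishing at $x_0$, with $\|\phi\|_L=\sup_{x\ne y}|\phi(x)-\phi(y)|/D(x,y)$. With $\widehat\delta_x\in L^*$ the evaluation at $x$, the Lipschitz-free space $\mathcal{F}(X,D)$ is the norm-closed linear span of $\{\widehat\delta_x:x\in X\}$ in $L^*$, with inherited norm $\|\cdot\|_{\mathcal{F}}$. For $Q\in\mathcal{F}(X,D)$: $\|Q|_{\mathcal{F}_P}=\sup\{\langle\phi,Q\rangle:\phi\in P,\ \|\phi\|_L\le1\}$; for $x,y\in X$: $D_P(x,y)=\|\widehat\delta_y-\widehat\delta_x|_{\mathcal{F}_P}$. We say that $P$ induces an asymmetrization if every $\phi\in L$ can be written $\phi=\phi_1-\phi_2$ with $\phi_1,\phi_2\in P$ and $\max\{\|\phi_1\|_L,\|\phi_2\|_L\}\le\|\phi\|_L\le\|\phi_1\|_L+\|\phi_2\|_L$; then $\|\cdot|_{\mathcal F_P}$ is an asymmetric (hemi-)norm and $D_P$ is a quasi-(hemi-)metric on $X$. The asymmetrization is nontrivial if $D_P\neq D$. For a quasi-(hemi-)metric $d$ on $X$ (a not necessarily symmetric $d\ge0$ with the triangle inequality and $x=y\iff d(x,y)=d(y,x)=0$): $\mathrm{SLip}_0(X,d)$ is the cone of $f:X\to\mathbb{R}$ with $f(x_0)=0$ for which there is $C>0$ with $f(x)-f(y)\le C\,d(y,x)$ for all $x,y$, and $\|f|_S$ is the infimum of such $C$. Let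 $\delta_x$ be the evaluation at $x$ on $\mathrm{SLip}_0(X,d)$. On $\mathrm{span}\{\delta_x:x\in X\}$ put $\|Q|_{\mathcal{F}_a}=\sup\{Q(f):\|f|_S\le1\}$. The semi-Lipschitz free space $\mathcal{F}_a(X,d)$ is the bicompletion of this asymmetric normed space, i.e. the (unique up to isometric isomorphism) asymmetric normed space, complete for the symmetrized norm $\|Q|+\|{-Q}|$, containing $\mathrm{span}\{\delta_x\}$ isometrically as a linear subspace dense for the symmetrized norm. Property $\mathbf{(S)}$ with respect to $P$: $P$ induces a nontrivial asymmetrization $D_P$ on $X$ and $\mathrm{SLip}_0(X,D_P)=P$. Property $\mathbf{(S^* )}$ (respectively $\mathbf{(S_0^* )}$): $\mathbf{(S)}$ holds and, in addition, $\|Q\|_{\mathcal{F}}=\|Q|_{\mathcal{F}_P}+\|{-Q}|_{\mathcal{F}_P}$ (respectively $\|Q\|_{\mathcal{F}}=\max\{\|Q|_{\mathcal{F}_P},\|{-Q}|_{\mathcal{F}_P}\}$) for every $Q\in\mathcal{F}(X,D)$. "Identical" in (i) is understood through the canonical identification $\sum_i\lambda_i\delta_{x_i}\leftrightarrow\sum_i\lambda_i\widehat\delta_{x_i}$ of $\mathrm{span}\{\delta_x\}$ with $\mathrm{span}\{\widehat\delta_x\}$, extended to the completions: the two spaces coincide as vector spaces and the two asymmetric norms agree. *)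

theory Defs
  imports "HOL-Analysis.Analysis" "HOL-Library.Function_Algebras"
begin

section \<open>Pointwise real vector space structure on functions\<close>

instantiation "fun" :: (type, real_vector) real_vector
begin

definition scaleR_fun :: "real \<Rightarrow> ('a \<Rightarrow> 'b) \<Rightarrow> 'a \<Rightarrow> 'b"
  where "scaleR_fun c f = (\<lambda>x. c *\<^sub>R f x)"

instance
  by standard (simp_all add: scaleR_fun_def fun_eq_iff scaleR_add_right scaleR_add_left)

end

text \<open>Functionals on a set \<open>S\<close> of functions are represented as total functions that vanish
  outside \<open>S\<close>, so that equality of functionals is equality of their values on \<open>S\<close>.\<close>

definition eval_on :: "('a \<Rightarrow> real) set \<Rightarrow> 'a \<Rightarrow> (('a \<Rightarrow> real) \<Rightarrow> real)"
  where "eval_on S x = (\<lambda>f. if f \<in> S then f x else 0)"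

section \<open>Lipschitz functions and the Lipschitz-free space\<close>

definition Lip0 :: "'a::metric_space \<Rightarrow> ('a \<Rightarrow> real) set"
  where "Lip0 x0 = {f. f x0 = 0 \<and> (\<exists>C. C-lipschitz_on UNIV f)}"

text \<open>The pairs with \<open>x = y\<close> contribute \<open>0 / 0 = 0\<close>; including them does not change the
  supremum, except that it gives the correct value \<open>0\<close> on a one-point space.\<close>

definition lip_norm :: "('a::metric_space \<Rightarrow> real) \<Rightarrow> real"
  where "lip_norm f = (SUP (x, y)\<in>UNIV. \<bar>f x - f y\<bar> / dist x y)"

definition Lip0_dual :: "'a::metric_space \<Rightarrow> (('a \<Rightarrow> real) \<Rightarrow> real) set"
  where "Lip0_dual x0 = {Q.
    (\<forall>f\<in>Lip0 x0. \<forall>g\<in>Lip0 x0. Q (f + g) = Q f + Q g) \<and>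
    (\<forall>c. \<forall>f\<in>Lip0 x0. Q (c *\<^sub>R f) = c * Q f) \<and>
    (\<exists>K. \<forall>f\<in>Lip0 x0. \<bar>Q f\<bar> \<le> K * lip_norm f) \<and>
    (\<forall>f. f \<notin> Lip0 x0 \<longrightarrow> Q f = 0)}"

definition dual_norm :: "'a::metric_space \<Rightarrow> (('a \<Rightarrow> real) \<Rightarrow> real) \<Rightarrow> real"
  where "dual_norm x0 Q = (SUP f\<in>{f \<in> Lip0 x0. lip_norm f \<le> 1}. \<bar>Q f\<bar>)"

abbreviation delta_hat :: "'a::metric_space \<Rightarrow> 'a \<Rightarrow> (('a \<Rightarrow> real) \<Rightarrow> real)"
  where "delta_hat x0 \<equiv> eval_on (Lip0 x0)"

definition lip_free :: "'a::metric_space \<Rightarrow> (('a \<Rightarrow> real) \<Rightarrow> real) set"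
  where "lip_free x0 = {Q \<in> Lip0_dual x0.
    \<forall>e>0. \<exists>R\<in>span (range (delta_hat x0)). dual_norm x0 (Q - R) < e}"

section \<open>Asymmetrization induced by a set of Lipschitz functions\<close>

definition FP_norm :: "('a::metric_space \<Rightarrow> real) set \<Rightarrow> (('a \<Rightarrow> real) \<Rightarrow> real) \<Rightarrow> real"
  where "FP_norm P Q = (SUP f\<in>{f \<in> P. lip_norm f \<le> 1}. Q f)"

definition DP :: "'a::metric_space \<Rightarrow> ('a \<Rightarrow> real) set \<Rightarrow> 'a \<Rightarrow> 'a \<Rightarrow> real"
  where "DP x0 P x y = FP_norm P (delta_hat x0 y - delta_hat x0 x)"

definition induces_asymmetrization :: "'a::metric_space \<Rightarrow> ('a \<Rightarrow> real) set \<Rightarrow> bool"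
  where "induces_asymmetrization x0 P \<longleftrightarrow>
    (\<forall>f\<in>Lip0 x0. \<exists>f1\<in>P. \<exists>f2\<in>P. f = f1 - f2 \<and>
      max (lip_norm f1) (lip_norm f2) \<le> lip_norm f \<and>
      lip_norm f \<le> lip_norm f1 + lip_norm f2)"

section \<open>Semi-Lipschitz functions\<close>

definition SLip0 :: "'a \<Rightarrow> ('a \<Rightarrow> 'a \<Rightarrow> real) \<Rightarrow> ('a \<Rightarrow> real) set"
  where "SLip0 x0 d = {f. f x0 = 0 \<and> (\<exists>C>0. \<forall>x y. f x - f y \<le> C * d y x)}"

definition slip_norm :: "('a \<Rightarrow> 'a \<Rightarrow> real) \<Rightarrow> ('a \<Rightarrow> real) \<Rightarrow> real"
  where "slip_norm d f = Inf {C. C > 0 \<and> (\<forall>x y. f x - f y \<le> C * d y x)}"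

abbreviation delta :: "'a \<Rightarrow> ('a \<Rightarrow> 'a \<Rightarrow> real) \<Rightarrow> 'a \<Rightarrow> (('a \<Rightarrow> real) \<Rightarrow> real)"
  where "delta x0 d \<equiv> eval_on (SLip0 x0 d)"

definition Fa_norm :: "'a \<Rightarrow> ('a \<Rightarrow> 'a \<Rightarrow> real) \<Rightarrow> (('a \<Rightarrow> real) \<Rightarrow> real) \<Rightarrow> real"
  where "Fa_norm x0 d Q = (SUP f\<in>{f \<in> SLip0 x0 d. slip_norm d f \<le> 1}. Q f)"

section \<open>Asymmetric normed spaces and bicompletions\<close>

definition linear_map_on :: "'v::real_vector set \<Rightarrow> ('v \<Rightarrow> 'w::real_vector) \<Rightarrow> bool"
  where "linear_map_on V T \<longleftrightarrow>
    (\<forall>u\<in>V. \<forall>v\<in>V. T (u + v) = T u + T v) \<and> (\<forall>c. \<forall>v\<in>V. T (c *\<^sub>R v) = c *\<^sub>R T v)"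

text \<open>Separation is the one of asymmetric (hemi-)norms: \<open>q u = 0\<close> alone does not force
  \<open>u = 0\<close>.\<close>

definition asym_normed_space :: "'v::real_vector set \<Rightarrow> ('v \<Rightarrow> real) \<Rightarrow> bool"
  where "asym_normed_space V q \<longleftrightarrow> subspace V \<and>
    (\<forall>v\<in>V. 0 \<le> q v) \<and>
    (\<forall>c\<ge>0. \<forall>v\<in>V. q (c *\<^sub>R v) = c * q v) \<and>
    (\<forall>u\<in>V. \<forall>v\<in>V. q (u + v) \<le> q u + q v) \<and>
    (\<forall>v\<in>V. q v = 0 \<and> q (- v) = 0 \<longrightarrow> v = 0)"

definition sym_norm :: "('v::real_vector \<Rightarrow> real) \<Rightarrow> 'v \<Rightarrow> real"
  where "sym_norm q v = q v + q (- v)"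

definition sym_max_norm :: "('v::real_vector \<Rightarrow> real) \<Rightarrow> 'v \<Rightarrow> real"
  where "sym_max_norm q v = max (q v) (q (- v))"

definition bicomplete :: "'v::real_vector set \<Rightarrow> ('v \<Rightarrow> real) \<Rightarrow> bool"
  where "bicomplete V q \<longleftrightarrow>
    (\<forall>s::nat \<Rightarrow> 'v. (\<forall>n. s n \<in> V) \<and>
        (\<forall>e>0. \<exists>N. \<forall>m\<ge>N. \<forall>n\<ge>N. sym_norm q (s m - s n) < e) \<longrightarrow>
      (\<exists>l\<in>V. (\<lambda>n. sym_norm q (s n - l)) \<longlonglongrightarrow> 0))"

definition is_bicompletion ::
    "'v::real_vector set \<Rightarrow> ('v \<Rightarrow> real) \<Rightarrow> 'e::real_vector set \<Rightarrow> ('e \<Rightarrow> real) \<Rightarrow> ('v \<Rightarrow> 'e) \<Rightarrow> bool"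
  where "is_bicompletion V p E q \<iota> \<longleftrightarrow>
    asym_normed_space E q \<and> bicomplete E q \<and>
    linear_map_on V \<iota> \<and> \<iota> ` V \<subseteq> E \<and> (\<forall>v\<in>V. q (\<iota> v) = p v) \<and>
    (\<forall>z\<in>E. \<forall>e>0. \<exists>v\<in>V. sym_norm q (z - \<iota> v) < e)"

text \<open>The semi-Lipschitz free space is determined only up to isometric isomorphism:
  \<open>(E, q)\<close>, with the embedding \<open>\<iota>\<close> of the span of the evaluations, is a model of it.
  Models exist, see \<open>semi_lip_free_exists\<close> below.\<close>

definition is_semi_lip_free ::
    "'a \<Rightarrow> ('a \<Rightarrow> 'a \<Rightarrow> real) \<Rightarrow> 'e::real_vector set \<Rightarrow> ('e \<Rightarrow> real) \<Rightarrow>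
      ((('a \<Rightarrow> real) \<Rightarrow> real) \<Rightarrow> 'e) \<Rightarrow> bool"
  where "is_semi_lip_free x0 d E q \<iota> \<longleftrightarrow>
    is_bicompletion (span (range (delta x0 d))) (Fa_norm x0 d) E q \<iota>"

definition isometric_iso ::
    "'v::real_vector set \<Rightarrow> ('v \<Rightarrow> real) \<Rightarrow> 'w::real_vector set \<Rightarrow> ('w \<Rightarrow> real) \<Rightarrow> ('v \<Rightarrow> 'w) \<Rightarrow> bool"
  where "isometric_iso V p W q T \<longleftrightarrow>
    linear_map_on V T \<and> bij_betw T V W \<and> (\<forall>v\<in>V. q (T v) = p v)"

section \<open>The properties S, S* and S0*\<close>

definition property_S :: "'a::metric_space \<Rightarrow> ('a \<Rightarrow> real) set \<Rightarrow> bool"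
  where "property_S x0 P \<longleftrightarrow>
    induces_asymmetrization x0 P \<and> DP x0 P \<noteq> dist \<and> SLip0 x0 (DP x0 P) = P"

definition property_S_star :: "'a::metric_space \<Rightarrow> ('a \<Rightarrow> real) set \<Rightarrow> bool"
  where "property_S_star x0 P \<longleftrightarrow> property_S x0 P \<and>
    (\<forall>Q\<in>lip_free x0. dual_norm x0 Q = FP_norm P Q + FP_norm P (- Q))"

definition property_S0_star :: "'a::metric_space \<Rightarrow> ('a \<Rightarrow> real) set \<Rightarrow> bool"
  where "property_S0_star x0 P \<longleftrightarrow> property_S x0 P \<and>
    (\<forall>Q\<in>lip_free x0. dual_norm x0 Q = max (FP_norm P Q) (FP_norm P (- Q)))"

section \<open>Existence of the semi-Lipschitz free space\<close>

lemma slip_norm_le_1_iff: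
  assumes d: "\<And>x y. 0 \<le> d x y" and f: "f \<in> SLip0 x0 d"
  shows "slip_norm d f \<le> 1 \<longleftrightarrow> (\<forall>x y. f x - f y \<le> d y x)"
proof -
  let ?A = "{C. C > 0 \<and> (\<forall>x y. f x - f y \<le> C * d y x)}"
  have bdd: "bdd_below ?A" unfolding bdd_below_def by (rule exI[of _ 0]) (simp add: less_imp_le)
  show ?thesis
  proof
    assume le: "slip_norm d f \<le> 1"
    show "\<forall>x y. f x - f y \<le> d y x"
    proof (intro allI, rule field_le_epsilon)
      fix x y and e :: real assume e: "0 < e"
      define h where "h = e / (d y x + 1)"
      have h: "h > 0" using e d[of y x] by (simp add: h_def)
      have ne: "?A \<noteq> {}" using f by (auto simp: SLip0_def)
      have "Inf ?A < 1 + h" using le h by (simp add: slip_norm_def)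
      from cInf_lessD[OF ne this] obtain C where C: "C \<in> ?A" "C < 1 + h" by (elim bexE)
      have "f x - f y \<le> C * d y x" using C by auto
      also have "\<dots> \<le> (1 + h) * d y x" using C d by (intro mult_right_mono) auto
      also have "\<dots> = d y x + h * d y x" by (simp add: algebra_simps)
      also have "h * d y x \<le> h * (d y x + 1)" using h by simp
      also have "h * (d y x + 1) = e" using d[of y x] by (simp add: h_def)
      finally show "f x - f y \<le> d y x + e" by simp
    qed
  next
    assume "\<forall>x y. f x - f y \<le> d y x"
    then have "1 \<in> ?A" by simp
    then show "slip_norm d f \<le> 1" unfolding slip_norm_def using bdd by (rule cInf_lower)
  qed
qed

lemma semi_lip_free_exists:
  fixes d :: "'a \<Rightarrow> 'a \<Rightarrow> real"
  assumes d: "\<And>x y. 0 \<le> d x y"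
  shows "\<exists>(E :: (('a \<Rightarrow> real) \<Rightarrow> real) set) q \<iota>. is_semi_lip_free x0 d E q \<iota>"
proof -
  let ?S = "SLip0 x0 d" and ?V = "span (range (delta x0 d))" and ?q = "Fa_norm x0 d"
  define B where "B = {f \<in> ?S. slip_norm d f \<le> 1}"
  have "(\<lambda>x. 0) \<in> ?S" using d by (auto simp: SLip0_def intro!: exI[of _ "1::real"])
  then have zB: "(\<lambda>x. 0) \<in> B"
    using slip_norm_le_1_iff[of d, OF d, of "\<lambda>x. 0" x0] d by (simp add: B_def)
  have Bd: "\<bar>f x\<bar> \<le> d x0 x + d x x0" if "f \<in> B" for f x
  proof -
    have "f \<in> ?S" "\<forall>x y. f x - f y \<le> d y x"
      using that slip_norm_le_1_iff[of d, OF d, of f x0] by (auto simp: B_def)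
    then have "f x0 = 0" "f x - f x0 \<le> d x0 x" "f x0 - f x \<le> d x x0"
      unfolding SLip0_def by blast+
    then show ?thesis using d[of x x0] d[of x0 x] by linarith
  qed
  have scS: "c *\<^sub>R f \<in> ?S" if "f \<in> ?S" "c > 0" for f c
  proof -
    from that obtain C where C: "f x0 = 0" "C > 0" "\<And>x y. f x - f y \<le> C * d y x"
      by (auto simp: SLip0_def)
    have "c * f x - c * f y \<le> (c * C) * d y x" for x y
      using mult_left_mono[OF C(3)[of x y], of c] that(2) by (simp add: algebra_simps)
    then show ?thesis using C that(2)
      by (auto simp: SLip0_def scaleR_fun_def intro!: exI[of _ "c * C"])
  qed
  have scB: "\<exists>c>0. c *\<^sub>R f \<in> B" if f: "f \<in> ?S" for f
  proof -
    from f obtain C where C: "C > 0" "\<And>x y. f x - f y \<le> C * d y x"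
      by (auto simp: SLip0_def)
    have "f x / C - f y / C \<le> d y x" for x y
      using C(2)[of x y] C(1) by (simp add: field_simps)
    moreover have "(1 / C) *\<^sub>R f \<in> ?S" using scS f C by simp
    ultimately have "(1 / C) *\<^sub>R f \<in> B"
      unfolding B_def using slip_norm_le_1_iff[of d, OF d, of "(1 / C) *\<^sub>R f" x0]
      by (simp add: scaleR_fun_def)
    then show ?thesis using C by (intro exI[of _ "1 / C"]) auto
  qed
  define E where "E = {Q :: ('a \<Rightarrow> real) \<Rightarrow> real. (\<forall>f. f \<notin> ?S \<longrightarrow> Q f = 0) \<and>
     (\<forall>f\<in>?S. \<forall>c>0. Q (c *\<^sub>R f) = c * Q f) \<and>
     (\<forall>e>0. \<exists>R\<in>?V. \<forall>f\<in>B. \<bar>Q f - R f\<bar> \<le> e)}"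
  define N where "N = {Q :: ('a \<Rightarrow> real) \<Rightarrow> real. (\<forall>f. f \<notin> ?S \<longrightarrow> Q f = 0) \<and>
     (\<forall>f\<in>?S. \<forall>c>0. Q (c *\<^sub>R f) = c * Q f) \<and> (\<exists>K. \<forall>f\<in>B. \<bar>Q f\<bar> \<le> K)}"
  have subN: "subspace N"
    unfolding subspace_def
  proof (intro conjI ballI allI)
    show "0 \<in> N" by (auto simp: N_def)
  next
    fix Q R assume QR: "Q \<in> N" "R \<in> N"
    then obtain K L where "\<forall>f\<in>B. \<bar>Q f\<bar> \<le> K" "\<forall>f\<in>B. \<bar>R f\<bar> \<le> L" by (auto simp: N_def)
    then have "\<bar>Q f + R f\<bar> \<le> K + L" if "f \<in> B" for f
      using that abs_triangle_ineq[of "Q f" "R f"] add_mono[of "\<bar>Q f\<bar>" K "\<bar>R f\<bar>" L] by auto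
    then show "Q + R \<in> N" using QR by (auto simp: N_def algebra_simps)
  next
    fix c :: real and Q assume Q: "Q \<in> N"
    then obtain K where "\<forall>f\<in>B. \<bar>Q f\<bar> \<le> K" by (auto simp: N_def)
    then have "\<forall>f\<in>B. \<bar>c * Q f\<bar> \<le> \<bar>c\<bar> * K" by (simp add: abs_mult mult_left_mono)
    then show "c *\<^sub>R Q \<in> N" using Q by (auto simp: N_def scaleR_fun_def[of c Q])
  qed
  have "range (delta x0 d) \<subseteq> N"
  proof
    fix Q assume "Q \<in> range (delta x0 d)"
    then obtain x where x: "Q = delta x0 d x" by auto
    have "\<forall>f\<in>B. \<bar>Q f\<bar> \<le> d x0 x + d x x0" using Bd by (auto simp: x eval_on_def B_def)
    then have "\<exists>K. \<forall>f\<in>B. \<bar>Q f\<bar> \<le> K" by blast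
    moreover have "Q (c *\<^sub>R f) = c * Q f" if "f \<in> ?S" "c > 0" for f c
      using that scS[OF that] unfolding x eval_on_def by (simp, simp add: scaleR_fun_def)
    moreover have "Q f = 0" if "f \<notin> ?S" for f using that by (simp add: x eval_on_def)
    ultimately show "Q \<in> N" by (simp add: N_def)
  qed
  then have VN: "?V \<subseteq> N" using subN by (rule span_minimal)
  have VE: "?V \<subseteq> E"
  proof
    fix Q assume "Q \<in> ?V"
    then have "Q \<in> N" "\<forall>e>0. \<exists>R\<in>?V. \<forall>f\<in>B. \<bar>Q f - R f\<bar> \<le> e"
      using VN by (auto intro!: bexI[of _ Q])
    then show "Q \<in> E" by (auto simp: N_def E_def)
  qed
  have EN: "E \<subseteq> N"
  proof
    fix Q assume Q: "Q \<in> E"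
    have "\<forall>e>0. \<exists>R\<in>?V. \<forall>f\<in>B. \<bar>Q f - R f\<bar> \<le> e" using Q by (simp add: E_def)
    from this[rule_format, of 1]
    obtain R where R: "R \<in> ?V" "\<forall>f\<in>B. \<bar>Q f - R f\<bar> \<le> 1" by auto
    obtain K where K: "\<forall>f\<in>B. \<bar>R f\<bar> \<le> K" using R VN by (auto simp: N_def)
    have "\<forall>f\<in>B. \<bar>Q f\<bar> \<le> K + 1"
    proof
      fix f assume "f \<in> B"
      then have "\<bar>Q f - R f\<bar> \<le> 1" "\<bar>R f\<bar> \<le> K" using R K by auto
      then show "\<bar>Q f\<bar> \<le> K + 1" by linarith
    qed
    then show "Q \<in> N" using Q by (auto simp: N_def E_def)
  qed
  have subE: "subspace E"
    unfolding subspace_def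
  proof (intro conjI ballI allI)
    show "0 \<in> E" using VE span_zero by blast
  next
    fix Q R assume QR: "Q \<in> E" "R \<in> E"
    have "Q + R \<in> N" using QR EN subN by (auto intro: subspace_add)
    moreover have "\<exists>T\<in>?V. \<forall>f\<in>B. \<bar>(Q + R) f - T f\<bar> \<le> e" if "e > 0" for e
    proof -
      have "e / 2 > 0" using that by simp
      then obtain T U where T: "T \<in> ?V" "\<forall>f\<in>B. \<bar>Q f - T f\<bar> \<le> e / 2"
        and U: "U \<in> ?V" "\<forall>f\<in>B. \<bar>R f - U f\<bar> \<le> e / 2"
        using QR unfolding E_def by blast
      have "\<bar>(Q + R) f - (T + U) f\<bar> \<le> e" if "f \<in> B" for f
        using T(2)[rule_format, OF that] U(2)[rule_format, OF that] unfolding plus_fun_apply by linarith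
      then show ?thesis using T(1) U(1) span_add by blast
    qed
    ultimately show "Q + R \<in> E" by (auto simp: N_def E_def)
  next
    fix c :: real and Q assume Q: "Q \<in> E"
    have "c *\<^sub>R Q \<in> N" using Q EN subN by (auto intro: subspace_scale)
    moreover have "\<exists>T\<in>?V. \<forall>f\<in>B. \<bar>(c *\<^sub>R Q) f - T f\<bar> \<le> e" if "e > 0" for e
    proof -
      have "e / (\<bar>c\<bar> + 1) > 0" using that by (simp add: add_nonneg_pos)
      then obtain T where T: "T \<in> ?V" "\<forall>f\<in>B. \<bar>Q f - T f\<bar> \<le> e / (\<bar>c\<bar> + 1)"
        using Q unfolding E_def by blast
      have "\<bar>(c *\<^sub>R Q) f - (c *\<^sub>R T) f\<bar> \<le> e" if "f \<in> B" for f
      proof -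
        have "\<bar>(c *\<^sub>R Q) f - (c *\<^sub>R T) f\<bar> = \<bar>c\<bar> * \<bar>Q f - T f\<bar>"
          by (simp add: scaleR_fun_def abs_mult[symmetric] right_diff_distrib)
        also have "\<dots> \<le> (\<bar>c\<bar> + 1) * (e / (\<bar>c\<bar> + 1))"
          using T(2) that by (intro mult_mono) auto
        also have "\<dots> = e" by simp
        finally show ?thesis .
      qed
      then show ?thesis using T(1) span_scale by blast
    qed
    ultimately show "c *\<^sub>R Q \<in> E" by (auto simp: N_def E_def)
  qed
  have bdd: "bdd_above (Q ` B)" if QN: "Q \<in> N" for Q
  proof -
    obtain K where "\<forall>f\<in>B. \<bar>Q f\<bar> \<le> K" using QN by (auto simp: N_def)
    then show ?thesis by (intro bdd_aboveI2[where M = K]) (simp add: abs_le_iff)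
  qed
  have q_eq: "?q Q = (SUP f\<in>B. Q f)" for Q by (simp add: Fa_norm_def B_def)
  have upper: "Q f \<le> ?q Q" if "Q \<in> N" "f \<in> B" for Q f
    unfolding q_eq using bdd[OF that(1)] that(2) by (intro cSUP_upper)
  have least: "?q Q \<le> K" if "\<And>f. f \<in> B \<Longrightarrow> Q f \<le> K" for Q K
    unfolding q_eq using that zB by (intro cSUP_least) auto
  have negN: "- Q \<in> N" if "Q \<in> N" for Q using subN that by (simp add: subspace_neg)
  have z0: "Q (\<lambda>x. 0) = 0" if "Q \<in> N" for Q
  proof -
    have "(\<lambda>x. 0) \<in> ?S" using zB by (simp add: B_def)
    then have "Q ((2::real) *\<^sub>R (\<lambda>x. 0)) = 2 * Q (\<lambda>x. 0)"
      using that unfolding N_def by simp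
    moreover have "(2::real) *\<^sub>R (\<lambda>x::'a. 0::real) = (\<lambda>x. 0)" by (simp add: scaleR_fun_def)
    ultimately show ?thesis by simp
  qed
  have nonneg: "0 \<le> ?q Q" if "Q \<in> N" for Q
    using upper[OF that zB] z0[OF that] by simp
  have sym_upper: "\<bar>Q f\<bar> \<le> sym_norm ?q Q" if "Q \<in> N" "f \<in> B" for Q f
    using upper[OF that] upper[OF negN[OF that(1)] that(2)] nonneg[OF that(1)] nonneg[OF negN[OF that(1)]]
    by (auto simp: sym_norm_def)
  have sym_least: "sym_norm ?q Q \<le> 2 * K" if "\<And>f. f \<in> B \<Longrightarrow> \<bar>Q f\<bar> \<le> K" for Q K
  proof -
    have "?q Q \<le> K" by (rule least) (use that in \<open>simp add: abs_le_iff\<close>)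
    moreover have "?q (- Q) \<le> K" by (rule least) (use that in \<open>simp add: abs_le_iff\<close>)
    ultimately show ?thesis by (simp add: sym_norm_def)
  qed
  have asym: "asym_normed_space E ?q"
    unfolding asym_normed_space_def
  proof (intro conjI ballI allI impI)
    show "subspace E" by (rule subE)
    show "0 \<le> ?q Q" if "Q \<in> E" for Q using nonneg that EN by auto
    show "?q (c *\<^sub>R Q) = c * ?q Q" if c: "0 \<le> c" and "Q \<in> E" for c Q
    proof (cases "c = 0")
      case True
      have "?q 0 = 0" unfolding q_eq using zB by (subst cSUP_const[symmetric, of B 0]) auto
      then show ?thesis using True by simp
    next
      case False
      then have c: "c > 0" using c by simp
      have QN: "Q \<in> N" using that EN by auto
      have cQN: "c *\<^sub>R Q \<in> N" using QN subN by (auto intro: subspace_scale)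
      show ?thesis
      proof (rule antisym)
        show "?q (c *\<^sub>R Q) \<le> c * ?q Q"
          using upper[OF QN] c by (intro least) (simp add: scaleR_fun_def)
        have "?q Q \<le> ?q (c *\<^sub>R Q) / c"
          using upper[OF cQN] c by (intro least) (simp add: scaleR_fun_def field_simps)
        then show "c * ?q Q \<le> ?q (c *\<^sub>R Q)" using c by (simp add: field_simps)
      qed
    qed
    show "?q (Q + R) \<le> ?q Q + ?q R" if "Q \<in> E" "R \<in> E" for Q R
    proof (rule least)
      fix f assume "f \<in> B"
      then show "(Q + R) f \<le> ?q Q + ?q R"
        using upper[of Q f] upper[of R f] that EN by (auto intro: add_mono)
    qed
    show "Q = 0" if "Q \<in> E" "?q Q = 0 \<and> ?q (- Q) = 0" for Q
    proof
      fix f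
      have QN: "Q \<in> N" using that EN by auto
      show "Q f = 0 f"
      proof (cases "f \<in> ?S")
        case True
        then obtain c where c: "c > 0" "c *\<^sub>R f \<in> B" using scB by blast
        have "Q (c *\<^sub>R f) = 0" using sym_upper[OF QN c(2)] that by (simp add: sym_norm_def)
        then show ?thesis using True c QN by (simp add: N_def)
      next
        case False
        then show ?thesis using QN by (simp add: N_def)
      qed
    qed
  qed
  have compl: "bicomplete E ?q"
    unfolding bicomplete_def
  proof (intro allI impI, elim conjE)
    fix s :: "nat \<Rightarrow> ('a \<Rightarrow> real) \<Rightarrow> real"
    assume s: "\<forall>n. s n \<in> E"
      and C: "\<forall>e>0. \<exists>N. \<forall>m\<ge>N. \<forall>n\<ge>N. sym_norm ?q (s m - s n) < e"
    have sN: "s n \<in> N" for n using s EN by auto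
    have dN: "s m - s n \<in> N" for m n using sN subN by (simp add: subspace_diff)
    have "Cauchy (\<lambda>n. s n f)" if "f \<in> B" for f
    proof (rule CauchyI)
      fix e :: real assume "e > 0"
      then obtain M where M: "\<forall>m\<ge>M. \<forall>n\<ge>M. sym_norm ?q (s m - s n) < e" using C by blast
      have "norm (s m f - s n f) < e" if "m \<ge> M" "n \<ge> M" for m n
      proof -
        have "sym_norm ?q (s m - s n) < e" using M that by blast
        then show ?thesis using sym_upper[OF dN \<open>f \<in> B\<close>, of m n] by simp
      qed
      then show "\<exists>M. \<forall>m\<ge>M. \<forall>n\<ge>M. norm (s m f - s n f) < e" by blast
    qed
    then have cB: "convergent (\<lambda>n. s n f)" if "f \<in> B" for f
      using that by (simp add: Cauchy_convergent)
    have hom: "s n (c *\<^sub>R f) = c * s n f" if "f \<in> ?S" "c > 0" for n c f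
      using sN[of n] that by (simp add: N_def)
    have cS: "convergent (\<lambda>n. s n f)" if f: "f \<in> ?S" for f
    proof -
      obtain c where c: "c > 0" "c *\<^sub>R f \<in> B" using scB f by blast
      have "convergent (\<lambda>n. c * s n f)" using cB[OF c(2)] hom[OF f c(1)] by simp
      then show ?thesis using c by (simp add: convergent_mult_const_iff)
    qed
    define l where "l = (\<lambda>f. if f \<in> ?S then lim (\<lambda>n. s n f) else 0)"
    have ll: "(\<lambda>n. s n f) \<longlonglongrightarrow> l f" if "f \<in> ?S" for f
      using cS[OF that] that by (simp add: l_def convergent_LIMSEQ_iff)
    have unif: "\<exists>M. \<forall>n\<ge>M. \<forall>f\<in>B. \<bar>s n f - l f\<bar> \<le> e" if e: "e > 0" for e
    proof -
      obtain M where M: "\<forall>m\<ge>M. \<forall>n\<ge>M. sym_norm ?q (s m - s n) < e" using C e by blast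
      have "\<bar>s n f - l f\<bar> \<le> e" if n: "n \<ge> M" and f: "f \<in> B" for n f
      proof (rule LIMSEQ_le_const2)
        show "(\<lambda>m. \<bar>s n f - s m f\<bar>) \<longlonglongrightarrow> \<bar>s n f - l f\<bar>"
          using f by (intro tendsto_intros ll) (simp add: B_def)
        show "\<exists>K. \<forall>m\<ge>K. \<bar>s n f - s m f\<bar> \<le> e"
        proof (intro exI[of _ M] allI impI)
          fix m assume "m \<ge> M"
          then have "sym_norm ?q (s n - s m) < e" using M n by blast
          then show "\<bar>s n f - s m f\<bar> \<le> e" using sym_upper[OF dN f, of n m] by simp
        qed
      qed
      then show ?thesis by blast
    qed
    have lE: "l \<in> E"
      unfolding E_def
    proof (intro CollectI conjI allI ballI impI)
      show "l f = 0" if "f \<notin> ?S" for f using that by (simp add: l_def)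
      show "l (c *\<^sub>R f) = c * l f" if f: "f \<in> ?S" and c: "c > 0" for f c
      proof (rule LIMSEQ_unique)
        show "(\<lambda>n. s n (c *\<^sub>R f)) \<longlonglongrightarrow> l (c *\<^sub>R f)" using scS[OF f c] by (rule ll)
        show "(\<lambda>n. s n (c *\<^sub>R f)) \<longlonglongrightarrow> c * l f"
          unfolding hom[OF f c] by (intro tendsto_intros ll f)
      qed
      fix e :: real assume e: "e > 0"
      then obtain M where M: "\<forall>f\<in>B. \<bar>s M f - l f\<bar> \<le> e / 2" using unif[of "e / 2"] by auto
      have "\<forall>e>0. \<exists>R\<in>?V. \<forall>f\<in>B. \<bar>s M f - R f\<bar> \<le> e" using s by (simp add: E_def)
      from this[rule_format, of "e / 2"]
      obtain R where R: "R \<in> ?V" "\<forall>f\<in>B. \<bar>s M f - R f\<bar> \<le> e / 2" using e by auto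
      have "\<bar>l f - R f\<bar> \<le> e" if "f \<in> B" for f
        using M[rule_format, OF that] R(2)[rule_format, OF that] by linarith
      then show "\<exists>R\<in>?V. \<forall>f\<in>B. \<bar>l f - R f\<bar> \<le> e" using R by blast
    qed
    have lN: "l \<in> N" using lE EN by auto
    have "(\<lambda>n. sym_norm ?q (s n - l)) \<longlonglongrightarrow> 0"
    proof (rule LIMSEQ_I)
      fix e :: real assume e: "e > 0"
      then obtain M where M: "\<forall>n\<ge>M. \<forall>f\<in>B. \<bar>s n f - l f\<bar> \<le> e / 3" using unif[of "e / 3"] by auto
      have "norm (sym_norm ?q (s n - l) - 0) < e" if n: "n \<ge> M" for n
      proof -
        have "s n - l \<in> N" using sN lN subN by (simp add: subspace_diff)
        then have "0 \<le> sym_norm ?q (s n - l)"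
          using nonneg negN by (simp add: sym_norm_def del: minus_diff_eq)
        moreover have "sym_norm ?q (s n - l) \<le> 2 * (e / 3)"
          using M n by (intro sym_least) auto
        ultimately show ?thesis using e by simp
      qed
      then show "\<exists>M. \<forall>n\<ge>M. norm (sym_norm ?q (s n - l) - 0) < e" by blast
    qed
    then show "\<exists>l\<in>E. (\<lambda>n. sym_norm ?q (s n - l)) \<longlonglongrightarrow> 0" using lE by blast
  qed
  have dense: "\<exists>v\<in>?V. sym_norm ?q (z - v) < e" if z: "z \<in> E" and e: "e > 0" for z e
  proof -
    have "\<forall>e>0. \<exists>R\<in>?V. \<forall>f\<in>B. \<bar>z f - R f\<bar> \<le> e" using z by (simp add: E_def)
    from this[rule_format, of "e / 3"]
    obtain R where R: "R \<in> ?V" "\<forall>f\<in>B. \<bar>z f - R f\<bar> \<le> e / 3" using e by auto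
    have "sym_norm ?q (z - R) \<le> 2 * (e / 3)" using R by (intro sym_least) auto
    then show ?thesis using R e by (intro bexI[of _ R]) auto
  qed
  have "is_semi_lip_free x0 d E ?q (\<lambda>Q. Q)"
    unfolding is_semi_lip_free_def is_bicompletion_def linear_map_on_def
    using asym compl VE dense by (intro conjI ballI allI impI) simp_all
  then show ?thesis by (intro exI)
qed

end

theory Submission
  imports Defs
begin

text \<open>
  Both spaces in the statement are completions of one and the same asymmetric normed space, so the
  isometry is the uniqueness of bicompletions (\<open>bicompletion_unique\<close>): the symmetrized norm
  makes a sequence of approximants in the dense subspace Cauchy, hence convergent in the other
  completion, and the asymmetric norms pass to the limit because they are 1-Lipschitz for their
  symmetrizations. The common space is the span of the evaluations on Lipschitz functions with the
  asymmetric norm of \<open>P\<close>.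

  The Lipschitz-free space is complete for the dual norm and contains this span as a dense
  subspace, so it is a bicompletion (\<open>lip_free_is_bicompletion\<close>) as soon as the symmetrization
  of the asymmetric norm is equivalent to the dual norm. The symmetrization is at most twice the dual norm since each of its terms is at
  most the dual norm. It is at least the dual norm
  (\<open>dual_norm_le_sym_FP_norm\<close>) because the asymmetrization decomposes the unit ball of
  Lipschitz functions into differences of elements of the unit ball of \<open>P\<close>.

  Property (S) makes \<open>P\<close> the cone of semi-Lipschitz functions, so the semi-Lipschitz free space
  completes the span of the evaluations on \<open>P\<close>, which is the image of the common
  space under restriction of functionals to \<open>P\<close>. Restriction is
  an isometry (\<open>semi_lip_free_is_bicompletion_of_delta_hat\<close>) because the two norms are
  suprema over the same set: a member of \<open>P\<close> has semi-Lipschitz constant at most 1 for \<open>D\<^sub>P\<close>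
  if and only if it has Lipschitz constant at most 1
  (\<open>slip_norm_le_1_iff_lip_norm_le_1\<close>).

  For the symmetrized norms, an isometric isomorphism for the asymmetric norms is one for any norm
  that is a fixed function of \<open>q v\<close> and \<open>q (- v)\<close>. The additional hypotheses say that the
  dual norm is such a function, namely the sum or the maximum.
\<close>

section \<open>Uniqueness of bicompletions\<close>

lemma sym_norm_minus: "sym_norm q (- v) = sym_norm q v"
  by (simp add: sym_norm_def)

lemma sym_norm_diff_commute: "sym_norm q (u - v) = sym_norm q (v - u)"
  using sym_norm_minus[of q "u - v"] by simp

context
  fixes V :: "'v::real_vector set" and q :: "'v \<Rightarrow> real"
  assumes asym: "asym_normed_space V q"
begin

lemma asym_subspace: "subspace V"
  using asym by (simp add: asym_normed_space_def)

lemma asym_triangle: "u \<in> V \<Longrightarrow> v \<in> V \<Longrightarrow> q (u + v) \<le> q u + q v"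
  using asym by (simp add: asym_normed_space_def)

lemma asym_nonneg: "v \<in> V \<Longrightarrow> 0 \<le> q v"
  using asym by (simp add: asym_normed_space_def)

lemma asym_scale: "0 \<le> c \<Longrightarrow> v \<in> V \<Longrightarrow> q (c *\<^sub>R v) = c * q v"
  using asym by (simp add: asym_normed_space_def)

lemma asym_zero: "q 0 = 0"
  using asym_scale[of 0 0] subspace_0[OF asym_subspace] by simp

lemma asym_le_sym_norm: "v \<in> V \<Longrightarrow> q v \<le> sym_norm q v"
  using asym_nonneg[of "- v"] subspace_neg[OF asym_subspace] by (simp add: sym_norm_def)

lemma sym_norm_nonneg: "v \<in> V \<Longrightarrow> 0 \<le> sym_norm q v"
  using asym_nonneg[of v] asym_le_sym_norm[of v] by linarith

lemma sym_norm_triangle: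
  assumes "u \<in> V" "v \<in> V" shows "sym_norm q (u + v) \<le> sym_norm q u + sym_norm q v"
proof -
  have "- u \<in> V" "- v \<in> V" using assms subspace_neg[OF asym_subspace] by auto
  then have "q (- u + - v) \<le> q (- u) + q (- v)" by (rule asym_triangle)
  then show ?thesis using asym_triangle[OF assms] by (simp add: sym_norm_def)
qed

lemma sym_norm_scale:
  assumes v: "v \<in> V" shows "sym_norm q (c *\<^sub>R v) = \<bar>c\<bar> * sym_norm q v"
proof -
  have nv: "- v \<in> V" using v subspace_neg[OF asym_subspace] by auto
  have pos: "sym_norm q (b *\<^sub>R v) = b * sym_norm q v" if "0 \<le> b" for b
    using asym_scale[OF that v] asym_scale[OF that nv] by (simp add: sym_norm_def algebra_simps)
  show ?thesis
  proof (cases "0 \<le> c")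
    case True
    then show ?thesis using pos by simp
  next
    case False
    then show ?thesis using pos[of "- c"] sym_norm_minus[of q "c *\<^sub>R v"] by simp
  qed
qed

lemma sym_norm_eq_0:
  assumes v: "v \<in> V" and le: "sym_norm q v \<le> 0" shows "v = 0"
proof -
  have "0 \<le> q v" "0 \<le> q (- v)"
    using asym_nonneg v subspace_neg[OF asym_subspace v] by auto
  then have "q v = 0 \<and> q (- v) = 0" using le by (simp add: sym_norm_def)
  then show ?thesis using asym v unfolding asym_normed_space_def by blast
qed

end

text \<open>The graph of the comparison map between two completions of the same space. It is written
  symmetrically in the two completions, so that the inverse of the map has the same graph up to
  the order of arguments, and injectivity and surjectivity of the map come from its
  well-definedness with the roles exchanged.\<close>

definition jointly_approximated ::
    "'v set \<Rightarrow> ('e::real_vector \<Rightarrow> real) \<Rightarrow> ('v \<Rightarrow> 'e) \<Rightarrow> ('w::real_vector \<Rightarrow> real) \<Rightarrow> ('v \<Rightarrow> 'w) \<Rightarrow>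
      'e \<Rightarrow> 'w \<Rightarrow> bool"
  where "jointly_approximated V q \<iota> r \<kappa> z w \<longleftrightarrow>
    (\<forall>e>0. \<exists>v\<in>V. sym_norm q (z - \<iota> v) < e \<and> sym_norm r (w - \<kappa> v) < e)"

lemma jointly_approximated_commute:
  "jointly_approximated V q \<iota> r \<kappa> z w \<longleftrightarrow> jointly_approximated V r \<kappa> q \<iota> w z"
  unfolding jointly_approximated_def by (auto simp: conj_commute)

context
  fixes V :: "'v::real_vector set" and p :: "'v \<Rightarrow> real"
    and E :: "'e::real_vector set" and q :: "'e \<Rightarrow> real" and \<iota> :: "'v \<Rightarrow> 'e"
    and F :: "'w::real_vector set" and r :: "'w \<Rightarrow> real" and \<kappa> :: "'v \<Rightarrow> 'w"
  assumes V: "subspace V"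
    and E: "is_bicompletion V p E q \<iota>" and F: "is_bicompletion V p F r \<kappa>"
begin

private lemma asym: "asym_normed_space E q" "asym_normed_space F r"
  using E F by (simp_all add: is_bicompletion_def)

private lemmas sub = asym(1)[THEN asym_subspace] asym(2)[THEN asym_subspace]

private lemma in_space: "v \<in> V \<Longrightarrow> \<iota> v \<in> E" "v \<in> V \<Longrightarrow> \<kappa> v \<in> F"
  using E F by (auto simp: is_bicompletion_def)

private lemma add: "u \<in> V \<Longrightarrow> v \<in> V \<Longrightarrow> \<iota> (u + v) = \<iota> u + \<iota> v"
    "u \<in> V \<Longrightarrow> v \<in> V \<Longrightarrow> \<kappa> (u + v) = \<kappa> u + \<kappa> v"
  and scale: "v \<in> V \<Longrightarrow> \<iota> (c *\<^sub>R v) = c *\<^sub>R \<iota> v" "v \<in> V \<Longrightarrow> \<kappa> (c *\<^sub>R v) = c *\<^sub>R \<kappa> v"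
  using E F by (simp_all add: is_bicompletion_def linear_map_on_def)

private lemma diff:
  assumes "u \<in> V" "v \<in> V" shows "\<iota> (u - v) = \<iota> u - \<iota> v" "\<kappa> (u - v) = \<kappa> u - \<kappa> v"
proof -
  have "(-1) *\<^sub>R v \<in> V" using subspace_scale[OF V assms(2)] .
  then show "\<iota> (u - v) = \<iota> u - \<iota> v" "\<kappa> (u - v) = \<kappa> u - \<kappa> v"
    using add[OF assms(1), of "(-1) *\<^sub>R v"] scale[OF assms(2), of "-1"] by simp_all
qed

private lemma isometric: "v \<in> V \<Longrightarrow> q (\<iota> v) = p v" "v \<in> V \<Longrightarrow> r (\<kappa> v) = p v"
  using E F by (simp_all add: is_bicompletion_def)

text \<open>Elements of the dense copy of \<open>V\<close> in \<open>E\<close> that approximate \<open>z\<close> are the images of a sequence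
  in \<open>V\<close> which is Cauchy for the symmetrization of \<open>p\<close>, hence has a limit in \<open>F\<close>.\<close>

lemma jointly_approximated_ex:
  assumes z: "z \<in> E"
  shows "\<exists>w\<in>F. jointly_approximated V q \<iota> r \<kappa> z w"
proof -
  have "\<exists>v\<in>V. sym_norm q (z - \<iota> v) < 1 / Suc n" for n
    using E z by (simp add: is_bicompletion_def)
  then obtain v where v: "\<And>n. v n \<in> V" "\<And>n. sym_norm q (z - \<iota> (v n)) < 1 / Suc n"
    by metis
  have sym: "sym_norm r (\<kappa> u) = sym_norm q (\<iota> u)" if u: "u \<in> V" for u
    using isometric[of u] isometric[of "- u"] subspace_neg[OF V u] u
      scale[OF u, of "-1"] by (simp add: sym_norm_def)
  have small: "\<exists>N. \<forall>n\<ge>N. sym_norm q (z - \<iota> (v n)) < e" if "e > 0" for e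
  proof -
    obtain N where N: "1 / Suc N < e" using \<open>e > 0\<close> by (rule nat_approx_posE)
    have "sym_norm q (z - \<iota> (v n)) < e" if "n \<ge> N" for n
    proof -
      have "1 / Suc n \<le> 1 / real (Suc N)" using that by (simp add: field_simps)
      then show ?thesis using v(2)[of n] N by linarith
    qed
    then show ?thesis by blast
  qed
  have "\<exists>N. \<forall>m\<ge>N. \<forall>n\<ge>N. sym_norm r (\<kappa> (v m) - \<kappa> (v n)) < e" if "e > 0" for e
  proof -
    obtain N where N: "\<And>n. n \<ge> N \<Longrightarrow> sym_norm q (z - \<iota> (v n)) < e / 2"
      using small[of "e / 2"] \<open>e > 0\<close> by auto
    have "sym_norm r (\<kappa> (v m) - \<kappa> (v n)) < e" if "m \<ge> N" "n \<ge> N" for m n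
    proof -
      have mn: "z - \<iota> (v m) \<in> E" "z - \<iota> (v n) \<in> E"
        using z v(1) in_space sub by (auto intro: subspace_diff)
      have "sym_norm r (\<kappa> (v m) - \<kappa> (v n)) = sym_norm q (\<iota> (v m) - \<iota> (v n))"
        using sym[of "v m - v n"] v(1) subspace_diff[OF V] by (simp add: diff)
      also have "\<dots> = sym_norm q (- (z - \<iota> (v m)) + (z - \<iota> (v n)))" by simp
      also have "\<dots> \<le> sym_norm q (- (z - \<iota> (v m))) + sym_norm q (z - \<iota> (v n))"
        using mn sub by (intro sym_norm_triangle[OF asym(1)] subspace_neg) auto
      also have "\<dots> < e" using N[OF that(1)] N[OF that(2)] unfolding sym_norm_minus by linarith
      finally show ?thesis .
    qed
    then show ?thesis by blast
  qed
  moreover have "\<forall>n. \<kappa> (v n) \<in> F" using v(1) in_space by blast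
  ultimately have C: "(\<forall>n. \<kappa> (v n) \<in> F) \<and>
      (\<forall>e>0. \<exists>N. \<forall>m\<ge>N. \<forall>n\<ge>N. sym_norm r (\<kappa> (v m) - \<kappa> (v n)) < e)" by blast
  have "bicomplete F r" using F by (simp add: is_bicompletion_def)
  from this[unfolded bicomplete_def, rule_format, OF C] obtain w where w: "w \<in> F" "(\<lambda>n. sym_norm r (\<kappa> (v n) - w)) \<longlonglongrightarrow> 0"
    by blast
  have "\<exists>u\<in>V. sym_norm q (z - \<iota> u) < e \<and> sym_norm r (w - \<kappa> u) < e" if "e > 0" for e
  proof -
    obtain N where N: "\<And>n. n \<ge> N \<Longrightarrow> sym_norm q (z - \<iota> (v n)) < e"
      using small[OF \<open>e > 0\<close>] by auto
    have "eventually (\<lambda>n. sym_norm r (\<kappa> (v n) - w) < e) sequentially"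
      using w(2) that by (rule order_tendstoD(2))
    then obtain M where "\<And>n. n \<ge> M \<Longrightarrow> sym_norm r (\<kappa> (v n) - w) < e"
      by (auto simp: eventually_sequentially)
    then show ?thesis using N[of "max M N"] v(1)
      by (intro bexI[of _ "v (max M N)"]) (auto simp: sym_norm_diff_commute[of r w])
  qed
  then show ?thesis using w(1) by (auto simp: jointly_approximated_def)
qed

lemma jointly_approximated_add:
  assumes "z \<in> E" "z' \<in> E" "w \<in> F" "w' \<in> F"
    and "jointly_approximated V q \<iota> r \<kappa> z w" "jointly_approximated V q \<iota> r \<kappa> z' w'"
  shows "jointly_approximated V q \<iota> r \<kappa> (z + z') (w + w')"
  unfolding jointly_approximated_def
proof (intro allI impI)
  fix e :: real assume "e > 0"
  then have "e / 2 > 0" by simp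
  then obtain v v' where v: "v \<in> V" "sym_norm q (z - \<iota> v) < e / 2" "sym_norm r (w - \<kappa> v) < e / 2"
    and v': "v' \<in> V" "sym_norm q (z' - \<iota> v') < e / 2" "sym_norm r (w' - \<kappa> v') < e / 2"
    using assms(5,6) unfolding jointly_approximated_def by meson
  have "sym_norm q (z + z' - \<iota> (v + v')) \<le> sym_norm q (z - \<iota> v) + sym_norm q (z' - \<iota> v')"
    using sym_norm_triangle[OF asym(1), of "z - \<iota> v" "z' - \<iota> v'"] assms(1,2) v(1) v'(1)
      in_space sub by (simp add: add subspace_diff algebra_simps)
  moreover have "sym_norm r (w + w' - \<kappa> (v + v')) \<le> sym_norm r (w - \<kappa> v) + sym_norm r (w' - \<kappa> v')"
    using sym_norm_triangle[OF asym(2), of "w - \<kappa> v" "w' - \<kappa> v'"] assms(3,4) v(1) v'(1)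
      in_space sub by (simp add: add subspace_diff algebra_simps)
  ultimately show "\<exists>u\<in>V. sym_norm q (z + z' - \<iota> u) < e \<and> sym_norm r (w + w' - \<kappa> u) < e"
    using v v' subspace_add[OF V] by (intro bexI[of _ "v + v'"]) auto
qed

lemma jointly_approximated_scale:
  assumes "z \<in> E" "w \<in> F" and "jointly_approximated V q \<iota> r \<kappa> z w"
  shows "jointly_approximated V q \<iota> r \<kappa> (c *\<^sub>R z) (c *\<^sub>R w)"
  unfolding jointly_approximated_def
proof (intro allI impI)
  fix e :: real assume e: "e > 0"
  \<comment> \<open>The summand 1 covers the case \<open>c = 0\<close>.\<close>
  then have "e / (\<bar>c\<bar> + 1) > 0" by (simp add: add_nonneg_pos)
  then obtain v where v: "v \<in> V" "sym_norm q (z - \<iota> v) < e / (\<bar>c\<bar> + 1)"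
      "sym_norm r (w - \<kappa> v) < e / (\<bar>c\<bar> + 1)"
    using assms(3) unfolding jointly_approximated_def by meson
  have m: "z - \<iota> v \<in> E" "w - \<kappa> v \<in> F"
    using assms(1,2) v(1) in_space sub by (auto intro: subspace_diff)
  have less: "\<bar>c\<bar> * a < e" if "0 \<le> a" "a < e / (\<bar>c\<bar> + 1)" for a
    using that e by (simp add: field_simps)
  have "sym_norm q (c *\<^sub>R z - \<iota> (c *\<^sub>R v)) < e"
    using sym_norm_scale[OF asym(1) m(1), of c] less[OF sym_norm_nonneg[OF asym(1) m(1)] v(2)] v(1)
    by (simp add: scale scaleR_diff_right)
  moreover have "sym_norm r (c *\<^sub>R w - \<kappa> (c *\<^sub>R v)) < e"
    using sym_norm_scale[OF asym(2) m(2), of c] less[OF sym_norm_nonneg[OF asym(2) m(2)] v(3)] v(1)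
    by (simp add: scale scaleR_diff_right)
  ultimately show "\<exists>u\<in>V. sym_norm q (c *\<^sub>R z - \<iota> u) < e \<and> sym_norm r (c *\<^sub>R w - \<kappa> u) < e"
    using v(1) subspace_scale[OF V] by blast
qed

text \<open>An asymmetric norm is 1-Lipschitz for its symmetrization.\<close>

lemma jointly_approximated_norm_le:
  assumes "z \<in> E" "w \<in> F" and "jointly_approximated V q \<iota> r \<kappa> z w"
  shows "q z \<le> r w"
proof (rule field_le_epsilon)
  fix e :: real assume "e > 0"
  then have "e / 2 > 0" by simp
  then obtain v where v: "v \<in> V" "sym_norm q (z - \<iota> v) < e / 2" "sym_norm r (w - \<kappa> v) < e / 2"
    using assms(3) unfolding jointly_approximated_def by meson
  have m: "z - \<iota> v \<in> E" "\<kappa> v - w \<in> F" "\<iota> v \<in> E"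
    using assms(1,2) v(1) in_space sub by (auto intro: subspace_diff)
  have "q z \<le> q (z - \<iota> v) + q (\<iota> v)" using asym_triangle[OF asym(1) m(1,3)] by simp
  moreover have "r (\<kappa> v) \<le> r (\<kappa> v - w) + r w" using asym_triangle[OF asym(2) m(2) assms(2)] by simp
  moreover have "q (z - \<iota> v) < e / 2" using asym_le_sym_norm[OF asym(1) m(1)] v(2) by linarith
  moreover have "r (\<kappa> v - w) < e / 2"
    using asym_le_sym_norm[OF asym(2) m(2)] v(3) by (simp add: sym_norm_diff_commute[of r w])
  ultimately show "q z \<le> r w + e" using isometric[OF v(1)] by linarith
qed

lemma jointly_approximated_embeddings:
  assumes "v \<in> V" shows "jointly_approximated V q \<iota> r \<kappa> (\<iota> v) (\<kappa> v)"
  unfolding jointly_approximated_def sym_norm_def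
  using assms asym_zero[OF asym(1)] asym_zero[OF asym(2)] by (auto intro!: bexI[of _ v])

end

text \<open>An element jointly approximated with two others forces their difference to be jointly
  approximated with zero, so that the difference has symmetrized norm zero.\<close>

lemma jointly_approximated_unique:
  assumes "subspace V" "is_bicompletion V p E q \<iota>" "is_bicompletion V p F r \<kappa>"
    and z: "z \<in> E" and w: "w \<in> F" "w' \<in> F"
    and zw: "jointly_approximated V q \<iota> r \<kappa> z w" "jointly_approximated V q \<iota> r \<kappa> z w'"
  shows "w = w'"
proof -
  note bic = assms(1-3) and bic' = assms(1,3,2)
  have asym: "asym_normed_space E q" "asym_normed_space F r"
    using assms by (simp_all add: is_bicompletion_def)
  note sub = asym(1)[THEN asym_subspace] asym(2)[THEN asym_subspace]
  have m: "- z \<in> E" "- w' \<in> F" "w - w' \<in> F" "0 \<in> E"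
    using z w sub by (auto intro: subspace_neg subspace_diff subspace_0)
  have "jointly_approximated V q \<iota> r \<kappa> (- z) (- w')"
    using jointly_approximated_scale[OF bic z w(2) zw(2), of "-1"] by simp
  from jointly_approximated_add[OF bic z m(1) w(1) m(2) zw(1) this]
  have d: "jointly_approximated V q \<iota> r \<kappa> 0 (w - w')" by simp
  then have d': "jointly_approximated V q \<iota> r \<kappa> 0 (w' - w)"
    using jointly_approximated_scale[OF bic m(4,3) d, of "-1"] by simp
  have "r (w - w') \<le> q 0"
    using d m by (intro jointly_approximated_norm_le[OF bic'])
      (simp_all add: jointly_approximated_commute[of V r])
  moreover have "r (w' - w) \<le> q 0"
    using d' m subspace_neg[OF sub(2) m(3)] by (intro jointly_approximated_norm_le[OF bic'])
      (simp_all add: jointly_approximated_commute[of V r])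
  ultimately have "sym_norm r (w - w') \<le> 0"
    using asym_zero[OF asym(1)] by (simp add: sym_norm_def)
  then show ?thesis using sym_norm_eq_0[OF asym(2) m(3)] by simp
qed

lemma bicompletion_unique:
  assumes V: "subspace V"
    and E: "is_bicompletion V p E q \<iota>" and F: "is_bicompletion V p F r \<kappa>"
  shows "\<exists>T. isometric_iso E q F r T \<and> (\<forall>v\<in>V. T (\<iota> v) = \<kappa> v)"
proof -
  let ?J = "jointly_approximated V q \<iota> r \<kappa>"
  note bic = V E F and bic' = V F E
  have comm: "jointly_approximated V r \<kappa> q \<iota> w z \<longleftrightarrow> ?J z w" for z w
    by (rule jointly_approximated_commute)
  have sub: "subspace E" "subspace F"
    using E F by (simp_all add: is_bicompletion_def asym_normed_space_def)
  define T where "T z = (SOME w. w \<in> F \<and> ?J z w)" for z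
  have T: "T z \<in> F" "?J z (T z)" if "z \<in> E" for z
  proof -
    have "\<exists>w. w \<in> F \<and> ?J z w" using jointly_approximated_ex[OF bic that] by blast
    from someI_ex[OF this] show "T z \<in> F" "?J z (T z)" by (auto simp: T_def)
  qed
  have T_eq: "T z = w" if "z \<in> E" "w \<in> F" "?J z w" for z w
    using jointly_approximated_unique[OF bic that(1) T(1)[OF that(1)] that(2) T(2)[OF that(1)] that(3)] .
  have "T (u + v) = T u + T v" if "u \<in> E" "v \<in> E" for u v
    using that T sub by (intro T_eq jointly_approximated_add[OF bic]) (auto intro: subspace_add)
  moreover have "T (c *\<^sub>R v) = c *\<^sub>R T v" if "v \<in> E" for c v
    using that T sub by (intro T_eq jointly_approximated_scale[OF bic]) (auto intro: subspace_scale)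
  moreover have "inj_on T E"
  proof (rule inj_onI)
    fix u v assume uv: "u \<in> E" "v \<in> E" "T u = T v"
    then have "?J u (T u)" "?J v (T u)" using T(2)[OF uv(1)] T(2)[OF uv(2)] by simp_all
    then show "u = v"
      using jointly_approximated_unique[OF bic' T(1) uv(1,2)] uv(1) by (simp add: comm)
  qed
  moreover have "T ` E = F"
  proof
    show "T ` E \<subseteq> F" using T by auto
    show "F \<subseteq> T ` E"
    proof
      fix w assume w: "w \<in> F"
      from jointly_approximated_ex[OF bic' w] obtain z where "z \<in> E" "?J z w"
        by (auto simp: comm)
      then show "w \<in> T ` E" using T_eq[OF _ w] by blast
    qed
  qed
  moreover have "r (T v) = q v" if "v \<in> E" for v
    using jointly_approximated_norm_le[OF bic that T[OF that]]
      jointly_approximated_norm_le[OF bic' T(1)[OF that] that] T(2)[OF that]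
    by (simp add: comm)
  moreover have "T (\<iota> v) = \<kappa> v" if "v \<in> V" for v
    using that E F jointly_approximated_embeddings[OF bic that]
    by (intro T_eq) (auto simp: is_bicompletion_def)
  ultimately show ?thesis
    unfolding isometric_iso_def linear_map_on_def bij_betw_def by blast
qed

lemma isometric_iso_inv:
  assumes V: "subspace V" and T: "isometric_iso V p W q T"
  shows "isometric_iso W q V p (the_inv_into V T)"
proof -
  let ?S = "the_inv_into V T"
  have add: "\<And>u v. u \<in> V \<Longrightarrow> v \<in> V \<Longrightarrow> T (u + v) = T u + T v"
    and scale: "\<And>c v. v \<in> V \<Longrightarrow> T (c *\<^sub>R v) = c *\<^sub>R T v"
    and bij: "bij_betw T V W" and iso: "\<And>v. v \<in> V \<Longrightarrow> q (T v) = p v"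
    using T by (auto simp: isometric_iso_def linear_map_on_def)
  have inj: "inj_on T V" using bij by (simp add: bij_betw_def)
  have S: "?S w \<in> V" "T (?S w) = w" if "w \<in> W" for w
    using that bij f_the_inv_into_f_bij_betw[OF bij, of w] the_inv_into_into[OF inj, of w V]
    by (auto simp: bij_betw_def)
  have S_eq: "?S w = v" if "v \<in> V" "T v = w" for v w
    using the_inv_into_f_f[OF inj that(1)] that(2) by simp
  have "?S (u + v) = ?S u + ?S v" if "u \<in> W" "v \<in> W" for u v
    using that S V by (intro S_eq) (auto simp: add intro: subspace_add)
  moreover have "?S (c *\<^sub>R v) = c *\<^sub>R ?S v" if "v \<in> W" for c v
    using that S V by (intro S_eq) (auto simp: scale intro: subspace_scale)
  moreover have "p (?S w) = q w" if "w \<in> W" for w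
    using iso[OF S(1)[OF that]] S(2)[OF that] by simp
  ultimately show ?thesis
    using bij_betw_the_inv_into[OF bij] by (simp add: isometric_iso_def linear_map_on_def)
qed

section \<open>Lipschitz functions and bounded functionals\<close>

lemma lip_norm_bdd_above:
  assumes "f \<in> Lip0 x0"
  shows "bdd_above (range (\<lambda>(x, y). \<bar>f x - f y\<bar> / dist x y))"
proof -
  obtain C where C: "C-lipschitz_on UNIV f" using assms by (auto simp: Lip0_def)
  have "\<bar>f x - f y\<bar> / dist x y \<le> C" for x y
    using lipschitz_onD[OF C, of x y] lipschitz_on_nonneg[OF C]
    by (cases "x = y") (auto simp: dist_real_def field_simps)
  then show ?thesis by (intro bdd_aboveI2[where M = C]) auto
qed

lemma abs_diff_le_lip_norm:
  assumes "f \<in> Lip0 x0" shows "\<bar>f x - f y\<bar> \<le> lip_norm f * dist x y"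
proof (cases "x = y")
  case False
  have "\<bar>f x - f y\<bar> / dist x y \<le> lip_norm f"
    using cSUP_upper[OF _ lip_norm_bdd_above[OF assms], of "(x, y)"] by (simp add: lip_norm_def)
  then show ?thesis using False by (simp add: field_simps)
qed simp

lemma lip_norm_le:
  fixes f :: "'a::metric_space \<Rightarrow> real"
  assumes "0 \<le> K" "\<And>x y. \<bar>f x - f y\<bar> \<le> K * dist x y" shows "lip_norm f \<le> K"
  unfolding lip_norm_def
proof (rule cSUP_least)
  fix z :: "'a \<times> 'a"
  have "\<bar>f (fst z) - f (snd z)\<bar> / dist (fst z) (snd z) \<le> K"
    using assms by (cases "fst z = snd z") (auto simp: field_simps)
  then show "(case z of (x, y) \<Rightarrow> \<bar>f x - f y\<bar> / dist x y) \<le> K" by (simp add: case_prod_beta)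
qed simp

lemma lip_norm_nonneg:
  fixes x0 :: "'a::metric_space"
  assumes "f \<in> Lip0 x0" shows "0 \<le> lip_norm f"
  using cSUP_upper[OF _ lip_norm_bdd_above[OF assms], of "(x0, x0)"] by (simp add: lip_norm_def)

lemma subspace_Lip0: "subspace (Lip0 x0)"
proof (unfold subspace_def, intro conjI ballI allI)
  show "0 \<in> Lip0 x0" by (auto simp: Lip0_def zero_fun_def intro!: lipschitz_on_constant)
next
  fix f g :: "'a \<Rightarrow> real" assume fg: "f \<in> Lip0 x0" "g \<in> Lip0 x0"
  then obtain C D where "C-lipschitz_on UNIV f" "D-lipschitz_on UNIV g" by (auto simp: Lip0_def)
  then have "(C + D)-lipschitz_on UNIV (f + g)"
    unfolding plus_fun_def by (rule lipschitz_on_add)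
  then show "f + g \<in> Lip0 x0" using fg by (auto simp: Lip0_def)
next
  fix c :: real and f :: "'a \<Rightarrow> real" assume f: "f \<in> Lip0 x0"
  then obtain C where "C-lipschitz_on UNIV f" by (auto simp: Lip0_def)
  then have "(\<bar>c\<bar> * C)-lipschitz_on UNIV (c *\<^sub>R f)"
    by (simp add: scaleR_fun_def lipschitz_on_cmult_real)
  then show "c *\<^sub>R f \<in> Lip0 x0" using f by (auto simp: Lip0_def scaleR_fun_def)
qed

lemma lip_norm_scale_le:
  assumes f: "f \<in> Lip0 x0" shows "lip_norm (c *\<^sub>R f) \<le> \<bar>c\<bar> * lip_norm f"
proof (rule lip_norm_le)
  show "0 \<le> \<bar>c\<bar> * lip_norm f" using lip_norm_nonneg[OF f] by simp
  show "\<bar>(c *\<^sub>R f) x - (c *\<^sub>R f) y\<bar> \<le> \<bar>c\<bar> * lip_norm f * dist x y" for x y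
    using mult_left_mono[OF abs_diff_le_lip_norm[OF f, of x y], of "\<bar>c\<bar>"]
    by (simp add: scaleR_fun_def abs_mult[symmetric] right_diff_distrib mult.assoc)
qed

lemma lip_norm_zero_le_1: "lip_norm (0 :: 'a::metric_space \<Rightarrow> real) \<le> 1"
  by (rule lip_norm_le) auto

lemma Lip0_dual_add: "Q \<in> Lip0_dual x0 \<Longrightarrow> f \<in> Lip0 x0 \<Longrightarrow> g \<in> Lip0 x0 \<Longrightarrow> Q (f + g) = Q f + Q g"
  and Lip0_dual_scale: "Q \<in> Lip0_dual x0 \<Longrightarrow> f \<in> Lip0 x0 \<Longrightarrow> Q (c *\<^sub>R f) = c * Q f"
  and Lip0_dual_outside: "Q \<in> Lip0_dual x0 \<Longrightarrow> f \<notin> Lip0 x0 \<Longrightarrow> Q f = 0"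
  by (simp_all add: Lip0_dual_def)

lemma Lip0_dual_zero: "Q \<in> Lip0_dual x0 \<Longrightarrow> Q 0 = 0"
  using Lip0_dual_scale[of Q x0 0 0] subspace_0[OF subspace_Lip0, of x0] by simp

lemma Lip0_dual_diff:
  assumes "Q \<in> Lip0_dual x0" "f \<in> Lip0 x0" "g \<in> Lip0 x0" shows "Q (f - g) = Q f - Q g"
  using Lip0_dual_add[OF assms(1,2), of "(-1) *\<^sub>R g"] Lip0_dual_scale[OF assms(1,3), of "-1"]
    subspace_scale[OF subspace_Lip0 assms(3), of "-1"] by simp

lemma Lip0_dual_bounded: "Q \<in> Lip0_dual x0 \<Longrightarrow> \<exists>K\<ge>0. \<forall>f\<in>Lip0 x0. \<bar>Q f\<bar> \<le> K * lip_norm f"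
proof -
  assume "Q \<in> Lip0_dual x0"
  then obtain K where K: "\<And>f. f \<in> Lip0 x0 \<Longrightarrow> \<bar>Q f\<bar> \<le> K * lip_norm f"
    unfolding Lip0_dual_def by blast
  have "\<bar>Q f\<bar> \<le> \<bar>K\<bar> * lip_norm f" if "f \<in> Lip0 x0" for f
    using K[OF that] mult_right_mono[OF abs_ge_self lip_norm_nonneg[OF that], of K] by linarith
  then show ?thesis by (intro exI[of _ "\<bar>K\<bar>"]) auto
qed

lemma abs_le_dual_norm:
  assumes Q: "Q \<in> Lip0_dual x0" and f: "f \<in> Lip0 x0" "lip_norm f \<le> 1"
  shows "\<bar>Q f\<bar> \<le> dual_norm x0 Q"
proof -
  obtain K where K: "0 \<le> K" "\<And>f. f \<in> Lip0 x0 \<Longrightarrow> \<bar>Q f\<bar> \<le> K * lip_norm f"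
    using Lip0_dual_bounded[OF Q] by auto
  have "\<bar>Q g\<bar> \<le> K" if "g \<in> Lip0 x0" "lip_norm g \<le> 1" for g
    using K(2)[OF that(1)] mult_left_mono[OF that(2) K(1)] by simp
  then have "bdd_above ((\<lambda>f. \<bar>Q f\<bar>) ` {f \<in> Lip0 x0. lip_norm f \<le> 1})"
    by (intro bdd_aboveI2[where M = K]) auto
  then show ?thesis unfolding dual_norm_def using f by (intro cSUP_upper) auto
qed

lemma dual_norm_le:
  assumes "\<And>f. f \<in> Lip0 x0 \<Longrightarrow> lip_norm f \<le> 1 \<Longrightarrow> \<bar>Q f\<bar> \<le> K" shows "dual_norm x0 Q \<le> K"
  unfolding dual_norm_def
proof (rule cSUP_least)
  show "{f \<in> Lip0 x0. lip_norm f \<le> 1} \<noteq> {}"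
    using lip_norm_zero_le_1 subspace_0[OF subspace_Lip0] by blast
qed (use assms in auto)

lemma dual_norm_nonneg:
  assumes "Q \<in> Lip0_dual x0" shows "0 \<le> dual_norm x0 Q"
  using abs_le_dual_norm[OF assms subspace_0[OF subspace_Lip0] lip_norm_zero_le_1] by linarith

lemma abs_le_dual_norm_mult:
  assumes Q: "Q \<in> Lip0_dual x0" and f: "f \<in> Lip0 x0"
  shows "\<bar>Q f\<bar> \<le> dual_norm x0 Q * lip_norm f"
proof (cases "lip_norm f = 0")
  case True
  then show ?thesis using Lip0_dual_bounded[OF Q] f by fastforce
next
  case False
  then have pos: "lip_norm f > 0" using lip_norm_nonneg[OF f] by simp
  let ?g = "(1 / lip_norm f) *\<^sub>R f"
  have "?g \<in> Lip0 x0" using f by (rule subspace_scale[OF subspace_Lip0])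
  moreover have "lip_norm ?g \<le> 1" using lip_norm_scale_le[OF f, of "1 / lip_norm f"] pos by simp
  ultimately have "\<bar>Q ?g\<bar> \<le> dual_norm x0 Q" by (rule abs_le_dual_norm[OF Q])
  then show ?thesis using Lip0_dual_scale[OF Q f] pos by (simp add: abs_mult field_simps)
qed

lemma subspace_Lip0_dual: "subspace (Lip0_dual x0)"
proof (unfold subspace_def, intro conjI ballI allI)
  show "0 \<in> Lip0_dual x0" by (auto simp: Lip0_dual_def intro: exI[of _ 0])
next
  fix Q R assume QR: "Q \<in> Lip0_dual x0" "R \<in> Lip0_dual x0"
  have "\<bar>Q f + R f\<bar> \<le> (dual_norm x0 Q + dual_norm x0 R) * lip_norm f" if "f \<in> Lip0 x0" for f
    using abs_le_dual_norm_mult[OF QR(1) that] abs_le_dual_norm_mult[OF QR(2) that]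
    unfolding distrib_right by linarith
  then have "\<exists>K. \<forall>f\<in>Lip0 x0. \<bar>(Q + R) f\<bar> \<le> K * lip_norm f" by auto
  then show "Q + R \<in> Lip0_dual x0"
    using QR by (simp add: Lip0_dual_def algebra_simps)
next
  fix c :: real and Q assume Q: "Q \<in> Lip0_dual x0"
  have "\<bar>c * Q f\<bar> \<le> (\<bar>c\<bar> * dual_norm x0 Q) * lip_norm f" if "f \<in> Lip0 x0" for f
    using mult_left_mono[OF abs_le_dual_norm_mult[OF Q that], of "\<bar>c\<bar>"]
    by (simp add: abs_mult mult.assoc)
  then have "\<exists>K. \<forall>f\<in>Lip0 x0. \<bar>c * Q f\<bar> \<le> K * lip_norm f" by blast
  then show "c *\<^sub>R Q \<in> Lip0_dual x0"
    using Q by (simp add: Lip0_dual_def scaleR_fun_def[of c Q] algebra_simps)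
qed

lemma dual_norm_triangle:
  assumes "Q \<in> Lip0_dual x0" "R \<in> Lip0_dual x0"
  shows "dual_norm x0 (Q + R) \<le> dual_norm x0 Q + dual_norm x0 R"
proof (rule dual_norm_le)
  fix f assume "f \<in> Lip0 x0" "lip_norm f \<le> 1"
  then show "\<bar>(Q + R) f\<bar> \<le> dual_norm x0 Q + dual_norm x0 R"
    using abs_le_dual_norm[OF assms(1), of f] abs_le_dual_norm[OF assms(2), of f]
    by (simp add: abs_le_iff)
qed

lemma dual_norm_scale_le:
  assumes "Q \<in> Lip0_dual x0" shows "dual_norm x0 (c *\<^sub>R Q) \<le> \<bar>c\<bar> * dual_norm x0 Q"
  by (rule dual_norm_le)
    (simp add: scaleR_fun_def abs_mult abs_le_dual_norm[OF assms] mult_left_mono)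

lemma delta_hat_in_Lip0_dual: "delta_hat x0 x \<in> Lip0_dual x0"
proof -
  have "\<bar>f x\<bar> \<le> dist x x0 * lip_norm f" if "f \<in> Lip0 x0" for f
    using abs_diff_le_lip_norm[OF that, of x x0] that by (simp add: Lip0_def mult.commute)
  moreover have "f + g \<in> Lip0 x0" if "f \<in> Lip0 x0" "g \<in> Lip0 x0" for f g :: "'a \<Rightarrow> real"
    using that by (rule subspace_add[OF subspace_Lip0])
  moreover have "c *\<^sub>R f \<in> Lip0 x0" if "f \<in> Lip0 x0" for c and f :: "'a \<Rightarrow> real"
    using that by (rule subspace_scale[OF subspace_Lip0])
  ultimately show ?thesis
    by (auto simp: Lip0_dual_def eval_on_def scaleR_fun_def)
qed

section \<open>The Lipschitz-free space\<close>

lemma span_delta_hat_Lip0_dual: "span (range (delta_hat x0)) \<subseteq> Lip0_dual x0"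
  using delta_hat_in_Lip0_dual by (intro span_minimal subspace_Lip0_dual) auto

lemma lip_free_subset: "lip_free x0 \<subseteq> Lip0_dual x0"
  by (auto simp: lip_free_def)

lemma span_delta_hat_lip_free: "span (range (delta_hat x0)) \<subseteq> lip_free x0"
proof
  fix Q assume Q: "Q \<in> span (range (delta_hat x0))"
  have "dual_norm x0 (Q - Q) \<le> 0" by (rule dual_norm_le) simp
  then have "\<exists>R\<in>span (range (delta_hat x0)). dual_norm x0 (Q - R) < e" if "e > 0" for e
    using that Q by (intro bexI[of _ Q]) linarith+
  then show "Q \<in> lip_free x0"
    using Q span_delta_hat_Lip0_dual by (auto simp: lip_free_def)
qed

lemma subspace_lip_free: "subspace (lip_free x0)"
proof (unfold subspace_def, intro conjI ballI allI)
  let ?V = "span (range (delta_hat x0))"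
  show "0 \<in> lip_free x0" using span_delta_hat_lip_free span_zero by blast
  show "Q + R \<in> lip_free x0" if QR: "Q \<in> lip_free x0" "R \<in> lip_free x0" for Q R
  proof -
    have d: "Q \<in> Lip0_dual x0" "R \<in> Lip0_dual x0" using QR lip_free_subset by auto
    have "\<exists>S\<in>?V. dual_norm x0 (Q + R - S) < e" if "e > 0" for e
    proof -
      have "e / 2 > 0" using that by simp
      then obtain T U where T: "T \<in> ?V" "dual_norm x0 (Q - T) < e / 2"
        and U: "U \<in> ?V" "dual_norm x0 (R - U) < e / 2"
        using QR unfolding lip_free_def by blast
      have "Q - T \<in> Lip0_dual x0" "R - U \<in> Lip0_dual x0"
        using d T(1) U(1) span_delta_hat_Lip0_dual
        by (auto intro!: subspace_diff[OF subspace_Lip0_dual])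
      from dual_norm_triangle[OF this]
      have "dual_norm x0 (Q + R - (T + U)) < e" using T(2) U(2) by (simp add: algebra_simps)
      then show ?thesis using T(1) U(1) span_add by blast
    qed
    then show ?thesis using subspace_add[OF subspace_Lip0_dual d] by (simp add: lip_free_def)
  qed
  show "c *\<^sub>R Q \<in> lip_free x0" if Q: "Q \<in> lip_free x0" for c Q
  proof -
    have d: "Q \<in> Lip0_dual x0" using Q lip_free_subset by auto
    have "\<exists>S\<in>?V. dual_norm x0 (c *\<^sub>R Q - S) < e" if e: "e > 0" for e
    proof -
      have "e / (\<bar>c\<bar> + 1) > 0" using that by (simp add: add_nonneg_pos)
      then obtain T where T: "T \<in> ?V" "dual_norm x0 (Q - T) < e / (\<bar>c\<bar> + 1)"
        using Q unfolding lip_free_def by blast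
      have QT: "Q - T \<in> Lip0_dual x0"
        using d T(1) span_delta_hat_Lip0_dual by (auto intro!: subspace_diff[OF subspace_Lip0_dual])
      have "dual_norm x0 (c *\<^sub>R Q - c *\<^sub>R T) \<le> \<bar>c\<bar> * dual_norm x0 (Q - T)"
        using dual_norm_scale_le[OF QT, of c] by (simp add: scaleR_diff_right)
      also have "\<dots> < e" using T(2) e dual_norm_nonneg[OF QT] by (simp add: field_simps)
      finally show ?thesis using T(1) span_scale by blast
    qed
    then show ?thesis using subspace_scale[OF subspace_Lip0_dual d] by (simp add: lip_free_def)
  qed
qed

text \<open>The limit is taken pointwise on Lipschitz functions. The Cauchy condition makes it uniform
  on the unit ball, which bounds the limit and lets it inherit approximants from a late term of
  the sequence.\<close>

lemma lip_free_complete: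
  fixes x0 :: "'a::metric_space" and s :: "nat \<Rightarrow> ('a \<Rightarrow> real) \<Rightarrow> real"
  assumes s: "\<And>n. s n \<in> lip_free x0"
    and C: "\<And>e. e > 0 \<Longrightarrow> \<exists>N. \<forall>m\<ge>N. \<forall>n\<ge>N. dual_norm x0 (s m - s n) < e"
  shows "\<exists>l\<in>lip_free x0. \<forall>e>0. \<exists>N. \<forall>n\<ge>N. dual_norm x0 (s n - l) \<le> e"
proof -
  have sD: "s n \<in> Lip0_dual x0" for n using s lip_free_subset by blast
  then have dD: "s m - s n \<in> Lip0_dual x0" for m n by (simp add: subspace_diff[OF subspace_Lip0_dual])
  have near: "\<exists>N. \<forall>m\<ge>N. \<forall>n\<ge>N. \<forall>f\<in>Lip0 x0. \<bar>s m f - s n f\<bar> \<le> e * lip_norm f" if e: "e > 0" for e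
  proof -
    obtain N where N: "\<forall>m\<ge>N. \<forall>n\<ge>N. dual_norm x0 (s m - s n) < e" using C[OF e] by blast
    have "\<bar>s m f - s n f\<bar> \<le> e * lip_norm f" if mn: "m \<ge> N" "n \<ge> N" and f: "f \<in> Lip0 x0" for m n f
    proof -
      have "dual_norm x0 (s m - s n) \<le> e" using N mn by (simp add: less_imp_le)
      then show ?thesis
        using abs_le_dual_norm_mult[OF dD[of m n] f] mult_right_mono[OF _ lip_norm_nonneg[OF f]]
        by fastforce
    qed
    then show ?thesis by blast
  qed
  have conv: "convergent (\<lambda>n. s n f)" if f: "f \<in> Lip0 x0" for f
  proof (rule Cauchy_convergent, rule CauchyI)
    fix e :: real assume e: "e > 0"
    define h where "h = e / (lip_norm f + 1)"
    have h: "h > 0" "h * lip_norm f < e"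
      using e lip_norm_nonneg[OF f] by (auto simp: h_def field_simps)
    obtain N where "\<forall>m\<ge>N. \<forall>n\<ge>N. \<bar>s m f - s n f\<bar> \<le> h * lip_norm f" using near[OF h(1)] f by blast
    then show "\<exists>M. \<forall>m\<ge>M. \<forall>n\<ge>M. norm (s m f - s n f) < e" using h(2) by force
  qed
  define l where "l f = (if f \<in> Lip0 x0 then lim (\<lambda>n. s n f) else 0)" for f
  have ll: "(\<lambda>n. s n f) \<longlonglongrightarrow> l f" if "f \<in> Lip0 x0" for f
    using conv[OF that] that by (simp add: l_def convergent_LIMSEQ_iff)
  have unif: "\<exists>N. \<forall>n\<ge>N. \<forall>f\<in>Lip0 x0. \<bar>s n f - l f\<bar> \<le> e * lip_norm f" if e: "e > 0" for e
  proof -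
    obtain N where N: "\<forall>m\<ge>N. \<forall>n\<ge>N. \<forall>f\<in>Lip0 x0. \<bar>s m f - s n f\<bar> \<le> e * lip_norm f"
      using near[OF e] by blast
    have "\<bar>s n f - l f\<bar> \<le> e * lip_norm f" if "n \<ge> N" "f \<in> Lip0 x0" for n f
    proof (rule LIMSEQ_le_const2)
      show "(\<lambda>m. \<bar>s n f - s m f\<bar>) \<longlonglongrightarrow> \<bar>s n f - l f\<bar>" using that by (intro tendsto_intros ll)
      show "\<exists>M. \<forall>m\<ge>M. \<bar>s n f - s m f\<bar> \<le> e * lip_norm f" using N that by blast
    qed
    then show ?thesis by blast
  qed
  have lD: "l \<in> Lip0_dual x0"
    unfolding Lip0_dual_def
  proof (intro CollectI conjI ballI allI impI)
    show "l (f + g) = l f + l g" if "f \<in> Lip0 x0" "g \<in> Lip0 x0" for f g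
    proof (rule LIMSEQ_unique)
      show "(\<lambda>n. s n (f + g)) \<longlonglongrightarrow> l (f + g)" using that by (intro ll subspace_add[OF subspace_Lip0])
      show "(\<lambda>n. s n (f + g)) \<longlonglongrightarrow> l f + l g"
        unfolding Lip0_dual_add[OF sD that] by (intro tendsto_intros ll that)
    qed
    show "l (c *\<^sub>R f) = c * l f" if "f \<in> Lip0 x0" for c f
    proof (rule LIMSEQ_unique)
      show "(\<lambda>n. s n (c *\<^sub>R f)) \<longlonglongrightarrow> l (c *\<^sub>R f)" using that by (intro ll subspace_scale[OF subspace_Lip0])
      show "(\<lambda>n. s n (c *\<^sub>R f)) \<longlonglongrightarrow> c * l f"
        unfolding Lip0_dual_scale[OF sD that] by (intro tendsto_intros ll that)
    qed
    obtain N where N: "\<And>f. f \<in> Lip0 x0 \<Longrightarrow> \<bar>s N f - l f\<bar> \<le> 1 * lip_norm f" using unif[of 1] by auto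
    have "\<bar>l f\<bar> \<le> (dual_norm x0 (s N) + 1) * lip_norm f" if "f \<in> Lip0 x0" for f
      using N[OF that] abs_le_dual_norm_mult[OF sD[of N] that] unfolding distrib_right by linarith
    then show "\<exists>K. \<forall>f\<in>Lip0 x0. \<bar>l f\<bar> \<le> K * lip_norm f" by blast
  qed (simp add: l_def)
  have lim: "\<exists>N. \<forall>n\<ge>N. dual_norm x0 (s n - l) \<le> e" if e: "e > 0" for e
  proof -
    obtain N where N: "\<And>n f. n \<ge> N \<Longrightarrow> f \<in> Lip0 x0 \<Longrightarrow> \<bar>s n f - l f\<bar> \<le> e * lip_norm f"
      using unif[OF e] by blast
    have "dual_norm x0 (s n - l) \<le> e" if n: "n \<ge> N" for n
    proof (rule dual_norm_le)
      fix f assume f: "f \<in> Lip0 x0" "lip_norm f \<le> 1"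
      have "e * lip_norm f \<le> e" using mult_left_mono[OF f(2), of e] e by simp
      then show "\<bar>(s n - l) f\<bar> \<le> e" using N[OF n f(1)] by simp
    qed
    then show ?thesis by blast
  qed
  have "\<exists>R\<in>span (range (delta_hat x0)). dual_norm x0 (l - R) < e" if e: "e > 0" for e
  proof -
    obtain N where N: "dual_norm x0 (s N - l) \<le> e / 2" using lim[of "e / 2"] e by auto
    have "\<forall>e>0. \<exists>R\<in>span (range (delta_hat x0)). dual_norm x0 (s N - R) < e"
      using s[of N] by (simp add: lip_free_def)
    from this[rule_format, of "e / 2"]
    obtain R where R: "R \<in> span (range (delta_hat x0))" "dual_norm x0 (s N - R) < e / 2"
      using e by auto
    have m: "s N - R \<in> Lip0_dual x0" "s N - l \<in> Lip0_dual x0"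
      using sD lD R(1) span_delta_hat_Lip0_dual by (auto intro!: subspace_diff[OF subspace_Lip0_dual])
    have "dual_norm x0 ((s N - R) + (-1) *\<^sub>R (s N - l)) \<le> dual_norm x0 (s N - R) + dual_norm x0 ((-1) *\<^sub>R (s N - l))"
      using m by (intro dual_norm_triangle subspace_scale[OF subspace_Lip0_dual])
    also have "\<dots> < e" using dual_norm_scale_le[OF m(2), of "-1"] R(2) N by simp
    finally show ?thesis using R(1) by (intro bexI[of _ R]) (auto simp: algebra_simps)
  qed
  then have "l \<in> lip_free x0" using lD by (simp add: lip_free_def)
  then show ?thesis using lim by blast
qed

section \<open>The asymmetric norm of a cone\<close>

lemma FP_norm_upper:
  assumes P: "P \<subseteq> Lip0 x0" and Q: "Q \<in> Lip0_dual x0" and f: "f \<in> P" "lip_norm f \<le> 1"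
  shows "Q f \<le> FP_norm P Q"
proof -
  have "Q g \<le> dual_norm x0 Q" if "g \<in> P" "lip_norm g \<le> 1" for g
    using abs_le_dual_norm[OF Q, of g] that P by fastforce
  then have "bdd_above (Q ` {f \<in> P. lip_norm f \<le> 1})" by (intro bdd_aboveI2[where M = "dual_norm x0 Q"]) auto
  then show ?thesis unfolding FP_norm_def using f by (intro cSUP_upper) auto
qed

lemma FP_norm_least:
  fixes P :: "('a::metric_space \<Rightarrow> real) set"
  assumes "0 \<in> P" and "\<And>f. f \<in> P \<Longrightarrow> lip_norm f \<le> 1 \<Longrightarrow> Q f \<le> K"
  shows "FP_norm P Q \<le> K"
  unfolding FP_norm_def
proof (rule cSUP_least)
  show "{f \<in> P. lip_norm f \<le> 1} \<noteq> {}" using assms(1) lip_norm_zero_le_1 by blast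
qed (use assms in auto)

context
  fixes x0 :: "'a::metric_space" and P :: "('a \<Rightarrow> real) set"
  assumes P: "P \<subseteq> Lip0 x0" and zero: "0 \<in> P"
begin

lemma FP_norm_nonneg:
  assumes "Q \<in> Lip0_dual x0" shows "0 \<le> FP_norm P Q"
  using FP_norm_upper[OF P assms zero lip_norm_zero_le_1] Lip0_dual_zero[OF assms] by simp

lemma FP_norm_le_dual_norm:
  assumes "Q \<in> Lip0_dual x0" shows "FP_norm P Q \<le> dual_norm x0 Q"
proof (rule FP_norm_least[OF zero])
  fix f assume "f \<in> P" "lip_norm f \<le> 1"
  then show "Q f \<le> dual_norm x0 Q" using abs_le_dual_norm[OF assms, of f] P by fastforce
qed

lemma sym_FP_norm_le_dual_norm:
  assumes "Q \<in> Lip0_dual x0" shows "sym_norm (FP_norm P) Q \<le> 2 * dual_norm x0 Q"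
proof -
  have "dual_norm x0 (- Q) \<le> dual_norm x0 Q" using dual_norm_scale_le[OF assms, of "-1"] by simp
  then show ?thesis
    using FP_norm_le_dual_norm[OF assms] FP_norm_le_dual_norm[OF subspace_neg[OF subspace_Lip0_dual assms]]
    by (simp add: sym_norm_def)
qed

lemma FP_norm_triangle:
  assumes "Q \<in> Lip0_dual x0" "R \<in> Lip0_dual x0"
  shows "FP_norm P (Q + R) \<le> FP_norm P Q + FP_norm P R"
  using FP_norm_upper[OF P assms(1)] FP_norm_upper[OF P assms(2)]
  by (intro FP_norm_least[OF zero]) (auto intro: add_mono)

lemma FP_norm_scale:
  assumes Q: "Q \<in> Lip0_dual x0" and c: "0 \<le> c"
  shows "FP_norm P (c *\<^sub>R Q) = c * FP_norm P Q"
proof (cases "c = 0")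
  case True
  have "0 \<in> Lip0_dual x0" by (rule subspace_0[OF subspace_Lip0_dual])
  then have "0 \<le> FP_norm P (0 :: ('a \<Rightarrow> real) \<Rightarrow> real)" by (rule FP_norm_nonneg)
  moreover have "FP_norm P (0 :: ('a \<Rightarrow> real) \<Rightarrow> real) \<le> 0" by (rule FP_norm_least[OF zero]) simp
  ultimately show ?thesis using True by simp
next
  case False
  then have c: "c > 0" using c by simp
  have cQ: "c *\<^sub>R Q \<in> Lip0_dual x0" using Q by (rule subspace_scale[OF subspace_Lip0_dual])
  show ?thesis
  proof (rule antisym)
    show "FP_norm P (c *\<^sub>R Q) \<le> c * FP_norm P Q"
      using FP_norm_upper[OF P Q] c by (intro FP_norm_least[OF zero]) (simp add: scaleR_fun_def)
    have "FP_norm P Q \<le> FP_norm P (c *\<^sub>R Q) / c"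
      using FP_norm_upper[OF P cQ] c
      by (intro FP_norm_least[OF zero]) (simp add: scaleR_fun_def field_simps)
    then show "c * FP_norm P Q \<le> FP_norm P (c *\<^sub>R Q)" using c by (simp add: field_simps)
  qed
qed

lemma DP_nonneg: "0 \<le> DP x0 P x y"
  unfolding DP_def
  by (intro FP_norm_nonneg subspace_diff[OF subspace_Lip0_dual] delta_hat_in_Lip0_dual)

lemma DP_upper:
  assumes "f \<in> P" "lip_norm f \<le> 1" shows "f x - f y \<le> DP x0 P y x"
  using FP_norm_upper[OF P subspace_diff[OF subspace_Lip0_dual delta_hat_in_Lip0_dual delta_hat_in_Lip0_dual] assms]
    assms(1) P by (auto simp: DP_def eval_on_def)

lemma DP_le_dist: "DP x0 P x y \<le> dist x y"
  unfolding DP_def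
proof (rule FP_norm_least[OF zero])
  fix f assume f: "f \<in> P" "lip_norm f \<le> 1"
  then have "f \<in> Lip0 x0" using P by auto
  then show "(delta_hat x0 y - delta_hat x0 x) f \<le> dist x y"
    using abs_diff_le_lip_norm[of f x0 y x] mult_right_mono[OF f(2) zero_le_dist[of y x]]
    by (simp add: eval_on_def dist_commute)
qed

text \<open>If \<open>f\<close> is 1-Lipschitz then \<open>f x - f y\<close> is one of the numbers whose supremum is
  the distance \<open>D\<^sub>P\<close> from \<open>y\<close> to \<open>x\<close>. Conversely \<open>D\<^sub>P \<le> D\<close>, and as \<open>D\<close> is symmetric a one-sided
  bound by it is a two-sided one.\<close>

lemma slip_norm_le_1_iff_lip_norm_le_1:
  assumes S: "SLip0 x0 (DP x0 P) = P" and f: "f \<in> P"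
  shows "slip_norm (DP x0 P) f \<le> 1 \<longleftrightarrow> lip_norm f \<le> 1"
proof -
  have "slip_norm (DP x0 P) f \<le> 1 \<longleftrightarrow> (\<forall>x y. f x - f y \<le> DP x0 P y x)"
    using S f by (intro slip_norm_le_1_iff[of _ _ x0] DP_nonneg) simp
  also have "\<dots> \<longleftrightarrow> lip_norm f \<le> 1"
  proof
    assume le: "\<forall>x y. f x - f y \<le> DP x0 P y x"
    have "f x - f y \<le> dist x y" for x y
      using le DP_le_dist[of y x] by (metis dist_commute order_trans)
    then have "\<bar>f x - f y\<bar> \<le> 1 * dist x y" for x y
      using dist_commute[of x y] by (metis abs_le_iff minus_diff_eq mult_1)
    then show "lip_norm f \<le> 1" by (intro lip_norm_le) auto
  qed (use DP_upper[OF f] in blast)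
  finally show ?thesis .
qed

text \<open>Every 1-Lipschitz function is a difference of two 1-Lipschitz members of \<open>P\<close>, on which
  \<open>Q\<close> and \<open>- Q\<close> are bounded by the two summands of the symmetrization.\<close>

lemma dual_norm_le_sym_FP_norm:
  assumes A: "induces_asymmetrization x0 P" and Q: "Q \<in> Lip0_dual x0"
  shows "dual_norm x0 Q \<le> sym_norm (FP_norm P) Q"
proof (rule dual_norm_le)
  fix f assume f: "f \<in> Lip0 x0" "lip_norm f \<le> 1"
  from A f(1) obtain g h where gh: "g \<in> P" "h \<in> P" "f = g - h"
      "max (lip_norm g) (lip_norm h) \<le> lip_norm f"
    unfolding induces_asymmetrization_def by blast
  have le: "lip_norm g \<le> 1" "lip_norm h \<le> 1" using gh(4) f(2) by auto
  have nQ: "- Q \<in> Lip0_dual x0" using Q by (rule subspace_neg[OF subspace_Lip0_dual])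
  have "Q f = Q g - Q h" using Lip0_dual_diff[OF Q, of g h] gh P by auto
  then show "\<bar>Q f\<bar> \<le> sym_norm (FP_norm P) Q"
    using FP_norm_upper[OF P Q gh(1) le(1)] FP_norm_upper[OF P Q gh(2) le(2)]
      FP_norm_upper[OF P nQ gh(1) le(1)] FP_norm_upper[OF P nQ gh(2) le(2)]
    by (simp add: sym_norm_def abs_le_iff)
qed

lemma asym_normed_space_lip_free:
  assumes A: "induces_asymmetrization x0 P"
  shows "asym_normed_space (lip_free x0) (FP_norm P)"
  unfolding asym_normed_space_def
proof (intro conjI ballI allI impI)
  have d: "Q \<in> Lip0_dual x0" if "Q \<in> lip_free x0" for Q using that lip_free_subset by blast
  show "subspace (lip_free x0)" by (rule subspace_lip_free)
  show "0 \<le> FP_norm P Q" if "Q \<in> lip_free x0" for Q using FP_norm_nonneg d that by blast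
  show "FP_norm P (c *\<^sub>R Q) = c * FP_norm P Q" if "0 \<le> c" "Q \<in> lip_free x0" for c Q
    using FP_norm_scale d that by blast
  show "FP_norm P (Q + R) \<le> FP_norm P Q + FP_norm P R"
    if "Q \<in> lip_free x0" "R \<in> lip_free x0" for Q R
    using FP_norm_triangle d that by blast
  show "Q = 0" if Q: "Q \<in> lip_free x0" and z: "FP_norm P Q = 0 \<and> FP_norm P (- Q) = 0" for Q
  proof
    fix f
    have "dual_norm x0 Q = 0"
      using dual_norm_le_sym_FP_norm[OF A d[OF Q]] dual_norm_nonneg[OF d[OF Q]] z
      by (simp add: sym_norm_def)
    then show "Q f = 0 f"
      using abs_le_dual_norm_mult[OF d[OF Q], of f] Lip0_dual_outside[OF d[OF Q], of f]
      by (cases "f \<in> Lip0 x0") auto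
  qed
qed

text \<open>The symmetrization of the asymmetric norm is equivalent to the norm of the dual, for which
  the Lipschitz-free space is complete and the evaluations span a dense subspace.\<close>

lemma lip_free_is_bicompletion:
  assumes A: "induces_asymmetrization x0 P"
  shows "is_bicompletion (span (range (delta_hat x0))) (FP_norm P) (lip_free x0) (FP_norm P) (\<lambda>Q. Q)"
  unfolding is_bicompletion_def
proof (intro conjI ballI allI impI)
  have d: "Q \<in> Lip0_dual x0" if "Q \<in> lip_free x0" for Q using that lip_free_subset by blast
  have dd: "Q - R \<in> Lip0_dual x0" if "Q \<in> lip_free x0" "R \<in> lip_free x0" for Q R
    using d that by (simp add: subspace_diff[OF subspace_Lip0_dual])
  show "asym_normed_space (lip_free x0) (FP_norm P)" by (rule asym_normed_space_lip_free[OF A])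
  show "linear_map_on (span (range (delta_hat x0))) (\<lambda>Q. Q)" by (simp add: linear_map_on_def)
  show "(\<lambda>Q. Q) ` span (range (delta_hat x0)) \<subseteq> lip_free x0" using span_delta_hat_lip_free by auto
  show "bicomplete (lip_free x0) (FP_norm P)"
    unfolding bicomplete_def
  proof (intro allI impI, elim conjE)
    fix s :: "nat \<Rightarrow> ('a \<Rightarrow> real) \<Rightarrow> real"
    assume s: "\<forall>n. s n \<in> lip_free x0"
      and C: "\<forall>e>0. \<exists>N. \<forall>m\<ge>N. \<forall>n\<ge>N. sym_norm (FP_norm P) (s m - s n) < e"
    have le: "dual_norm x0 (s m - s n) \<le> sym_norm (FP_norm P) (s m - s n)" for m n
      using dual_norm_le_sym_FP_norm[OF A dd] s by blast
    have "\<exists>N. \<forall>m\<ge>N. \<forall>n\<ge>N. dual_norm x0 (s m - s n) < e" if "e > 0" for e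
      using C that le by (meson le_less_trans)
    then obtain l where l: "l \<in> lip_free x0" "\<And>e. e > 0 \<Longrightarrow> \<exists>N. \<forall>n\<ge>N. dual_norm x0 (s n - l) \<le> e"
      using lip_free_complete[of s x0] s by blast
    have "(\<lambda>n. sym_norm (FP_norm P) (s n - l)) \<longlonglongrightarrow> 0"
    proof (rule LIMSEQ_I)
      fix e :: real assume e: "e > 0"
      then obtain N where N: "\<forall>n\<ge>N. dual_norm x0 (s n - l) \<le> e / 3" using l(2)[of "e / 3"] by auto
      have "norm (sym_norm (FP_norm P) (s n - l) - 0) < e" if "n \<ge> N" for n
      proof -
        have m: "s n - l \<in> Lip0_dual x0" using dd s l(1) by blast
        have "0 \<le> sym_norm (FP_norm P) (s n - l)"
          using dual_norm_nonneg[OF m] dual_norm_le_sym_FP_norm[OF A m] by linarith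
        moreover have "dual_norm x0 (s n - l) \<le> e / 3" using N that by blast
        ultimately show ?thesis using sym_FP_norm_le_dual_norm[OF m] e by simp
      qed
      then show "\<exists>N. \<forall>n\<ge>N. norm (sym_norm (FP_norm P) (s n - l) - 0) < e" by blast
    qed
    then show "\<exists>l\<in>lip_free x0. (\<lambda>n. sym_norm (FP_norm P) (s n - l)) \<longlonglongrightarrow> 0" using l(1) by blast
  qed
  fix Q and e :: real assume Q: "Q \<in> lip_free x0" and e: "e > 0"
  then have "\<forall>e>0. \<exists>R\<in>span (range (delta_hat x0)). dual_norm x0 (Q - R) < e"
    by (simp add: lip_free_def)
  from this[rule_format, of "e / 2"]
  obtain R where R: "R \<in> span (range (delta_hat x0))" "dual_norm x0 (Q - R) < e / 2"
    using e by auto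
  have "R \<in> lip_free x0" using R(1) span_delta_hat_lip_free by blast
  then have "sym_norm (FP_norm P) (Q - R) < e"
    using sym_FP_norm_le_dual_norm[OF dd[OF Q]] R(2) by fastforce
  then show "\<exists>R\<in>span (range (delta_hat x0)). sym_norm (FP_norm P) (Q - R) < e" using R(1) by blast
qed simp

end

section \<open>Comparison with the semi-Lipschitz free space\<close>

definition restrict_functional :: "'b set \<Rightarrow> ('b \<Rightarrow> real) \<Rightarrow> 'b \<Rightarrow> real"
  where "restrict_functional S Q = (\<lambda>f. if f \<in> S then Q f else 0)"

lemma linear_restrict_functional: "linear (restrict_functional S)"
  by (rule linearI) (auto simp: restrict_functional_def fun_eq_iff scaleR_fun_def)

lemma restrict_eval_on:
  "P \<subseteq> L \<Longrightarrow> restrict_functional P (eval_on L x) = eval_on P x"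
  by (auto simp: restrict_functional_def eval_on_def fun_eq_iff)

text \<open>Under property (S) a model of the semi-Lipschitz free space is also a completion of the span
  of the evaluations on Lipschitz functions: that span maps onto the span of the evaluations on
  \<open>P\<close> by restriction, and both norms are suprema over the same ball of \<open>P\<close>.\<close>

lemma semi_lip_free_is_bicompletion_of_delta_hat:
  fixes x0 :: "'a::metric_space"
  assumes P: "P \<subseteq> Lip0 x0" and zero: "0 \<in> P" and S: "SLip0 x0 (DP x0 P) = P"
    and E: "is_semi_lip_free x0 (DP x0 P) E q \<iota>"
  shows "is_bicompletion (span (range (delta_hat x0))) (FP_norm P) E q
    (\<lambda>Q. \<iota> (restrict_functional P Q))"
proof -
  let ?r = "restrict_functional P"
  let ?V = "span (range (delta_hat x0))" and ?W = "span (range (delta x0 (DP x0 P)))"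
  have "?r ` range (delta_hat x0) = range (delta x0 (DP x0 P))"
    using restrict_eval_on[OF P] by (simp add: image_image S)
  then have onto: "?r ` ?V = ?W"
    using linear_span_image[OF linear_restrict_functional, of P "range (delta_hat x0)"]
    by simp
  have "{f \<in> SLip0 x0 (DP x0 P). slip_norm (DP x0 P) f \<le> 1} = {f \<in> P. lip_norm f \<le> 1}"
    using slip_norm_le_1_iff_lip_norm_le_1[OF P zero S] S by auto
  then have norm: "Fa_norm x0 (DP x0 P) (?r Q) = FP_norm P Q" for Q
    unfolding Fa_norm_def FP_norm_def by (auto simp: restrict_functional_def intro!: SUP_cong)
  have r: "?r (Q + R) = ?r Q + ?r R" "?r (c *\<^sub>R Q) = c *\<^sub>R ?r Q" for Q R c
    by (simp_all add: linear_add[OF linear_restrict_functional]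
        linear_scale[OF linear_restrict_functional])
  have rW: "?r Q \<in> ?W" if "Q \<in> ?V" for Q using onto that by blast
  have E': "is_bicompletion ?W (Fa_norm x0 (DP x0 P)) E q \<iota>"
    using E by (simp add: is_semi_lip_free_def)
  show ?thesis
    unfolding is_bicompletion_def
  proof (intro conjI ballI allI impI)
    show "asym_normed_space E q" "bicomplete E q" using E' by (simp_all add: is_bicompletion_def)
    show "linear_map_on ?V (\<lambda>Q. \<iota> (?r Q))"
      using E' rW by (simp add: is_bicompletion_def linear_map_on_def r)
    show "(\<lambda>Q. \<iota> (?r Q)) ` ?V \<subseteq> E" using E' rW by (auto simp: is_bicompletion_def)
    show "q (\<iota> (?r Q)) = FP_norm P Q" if "Q \<in> ?V" for Q
      using E' rW[OF that] norm by (simp add: is_bicompletion_def)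
    show "\<exists>Q\<in>?V. sym_norm q (z - \<iota> (?r Q)) < e" if "z \<in> E" "e > 0" for z e
    proof -
      obtain v where "v \<in> ?W" and "sym_norm q (z - \<iota> v) < e"
        using E' \<open>z \<in> E\<close> \<open>e > 0\<close> unfolding is_bicompletion_def by blast
      moreover from \<open>v \<in> ?W\<close> obtain Q where "Q \<in> ?V" "v = ?r Q"
        unfolding onto[symmetric] by (elim imageE)
      ultimately show ?thesis by blast
    qed
  qed
qed

lemma property_S_isometric_iso:
  fixes x0 :: "'a::metric_space"
  assumes P: "P \<subseteq> Lip0 x0" and zero: "0 \<in> P" and S: "property_S x0 P"
    and E: "is_semi_lip_free x0 (DP x0 P) E q \<iota>"
  shows "\<exists>T. isometric_iso (lip_free x0) (FP_norm P) E q T \<and>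
    (\<forall>A c. finite A \<longrightarrow>
      T (\<Sum>x\<in>A. c x *\<^sub>R delta_hat x0 x) = \<iota> (\<Sum>x\<in>A. c x *\<^sub>R delta x0 (DP x0 P) x))"
proof -
  let ?r = "restrict_functional P"
  have A: "induces_asymmetrization x0 P" and SP: "SLip0 x0 (DP x0 P) = P"
    using S by (simp_all add: property_S_def)
  obtain T where T: "isometric_iso (lip_free x0) (FP_norm P) E q T"
      "\<And>Q. Q \<in> span (range (delta_hat x0)) \<Longrightarrow> T Q = \<iota> (?r Q)"
    using bicompletion_unique[OF subspace_span lip_free_is_bicompletion[OF P zero A]
        semi_lip_free_is_bicompletion_of_delta_hat[OF P zero SP E]] by auto
  have "T (\<Sum>x\<in>A. c x *\<^sub>R delta_hat x0 x) = \<iota> (\<Sum>x\<in>A. c x *\<^sub>R delta x0 (DP x0 P) x)" for A c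
  proof -
    have "(\<Sum>x\<in>A. c x *\<^sub>R delta_hat x0 x) \<in> span (range (delta_hat x0))"
      by (intro span_sum span_scale span_base) simp
    moreover have "?r (\<Sum>x\<in>A. c x *\<^sub>R delta_hat x0 x) = (\<Sum>x\<in>A. c x *\<^sub>R delta x0 (DP x0 P) x)"
      by (simp add: linear_sum[OF linear_restrict_functional]
          linear_scale[OF linear_restrict_functional] restrict_eval_on[OF P] SP)
    ultimately show ?thesis using T(2) by simp
  qed
  then show ?thesis using T(1) by blast
qed

lemma isometric_iso_symmetrized:
  assumes V: "subspace V" and T: "isometric_iso V p W q T"
    and n: "\<And>v. v \<in> V \<Longrightarrow> n v = \<phi> (p v) (p (- v))"
  shows "\<exists>U. isometric_iso W (\<lambda>w. \<phi> (q w) (q (- w))) V n U"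
proof -
  have "T (- v) = - T v" "- v \<in> V" if "v \<in> V" for v
    using T that subspace_neg[OF V that] scaleR_minus1_left[of v] scaleR_minus1_left[of "T v"]
    unfolding isometric_iso_def linear_map_on_def by metis+
  then have "q (- T v) = p (- v)" if "v \<in> V" for v
    using T that unfolding isometric_iso_def by metis
  then have "isometric_iso V n W (\<lambda>w. \<phi> (q w) (q (- w))) T"
    using T n by (simp add: isometric_iso_def)
  then show ?thesis using isometric_iso_inv[OF V] by blast
qed

theorem proposition3p18:
  fixes x0 :: "'a::metric_space" and P :: "('a \<Rightarrow> real) set"
    and E :: "'e::real_vector set" and q :: "'e \<Rightarrow> real"
    and \<iota> :: "(('a \<Rightarrow> real) \<Rightarrow> real) \<Rightarrow> 'e"
  assumes "P \<subseteq> Lip0 x0" and "convex_cone P"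
    and "is_semi_lip_free x0 (DP x0 P) E q \<iota>"
  shows "(property_S x0 P \<longrightarrow>
        (\<exists>T. isometric_iso (lip_free x0) (FP_norm P) E q T \<and>
          (\<forall>A c. finite A \<longrightarrow>
            T (\<Sum>x\<in>A. c x *\<^sub>R delta_hat x0 x) = \<iota> (\<Sum>x\<in>A. c x *\<^sub>R delta x0 (DP x0 P) x))))
    \<and> (property_S_star x0 P \<longrightarrow>
        (\<exists>T. isometric_iso E (sym_norm q) (lip_free x0) (dual_norm x0) T))
    \<and> (property_S0_star x0 P \<longrightarrow>
        (\<exists>T. isometric_iso E (sym_max_norm q) (lip_free x0) (dual_norm x0) T))"
proof -
  have zero: "0 \<in> P" using assms(2) by (simp add: convex_cone_contains_0)
  note iso = property_S_isometric_iso[OF assms(1) zero _ assms(3)]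
  have sym: "sym_norm q = (\<lambda>w. q w + q (- w))" "sym_max_norm q = (\<lambda>w. max (q w) (q (- w)))"
    by (simp_all add: fun_eq_iff sym_norm_def sym_max_norm_def)
  show ?thesis
  proof (intro conjI impI)
    assume "property_S x0 P"
    then show "\<exists>T. isometric_iso (lip_free x0) (FP_norm P) E q T \<and>
          (\<forall>A c. finite A \<longrightarrow>
            T (\<Sum>x\<in>A. c x *\<^sub>R delta_hat x0 x) = \<iota> (\<Sum>x\<in>A. c x *\<^sub>R delta x0 (DP x0 P) x))"
      by (rule iso)
  next
    assume S: "property_S_star x0 P"
    then obtain T where "isometric_iso (lip_free x0) (FP_norm P) E q T"
      using iso unfolding property_S_star_def by blast
    then show "\<exists>T. isometric_iso E (sym_norm q) (lip_free x0) (dual_norm x0) T"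
      unfolding sym using S
      by (intro isometric_iso_symmetrized[OF subspace_lip_free, where \<phi> = "(+)"])
        (auto simp: property_S_star_def)
  next
    assume S: "property_S0_star x0 P"
    then obtain T where "isometric_iso (lip_free x0) (FP_norm P) E q T"
      using iso unfolding property_S0_star_def by blast
    then show "\<exists>T. isometric_iso E (sym_max_norm q) (lip_free x0) (dual_norm x0) T"
      unfolding sym using S
      by (intro isometric_iso_symmetrized[OF subspace_lip_free, where \<phi> = max])
        (auto simp: property_S0_star_def)
  qed
qed

end
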